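(* Let $h\geq 3$, let $G$ be a VPT graph which is a minimal non $[h,2,1]$ graph, and let $K$ be a principal clique of $G$. Then: (i) $V(B(G/K))=V(G)\setminus K$; (ii) for every $v\in V(G)\setminus K$, $|N(v)\cap K|>1$; (iii) $B(G/K)$ is $(h+1)$-vertex critical; (iv) for all distinct $s_1,s_2\in V(G)\setminus K$, $N(s_1)\cap K\neq N(s_2)\cap K$.
   Context: All graphs are finite, simple and connected. A VPT representation of $G$ is a tree $T$ together with paths $(P_v)_{v\in V(G)}$ of $T$ such that $uv\in E(G)$ iff $P_u$ and $P_v$ share a vertex; $G$ is VPT if it has one. $[h,2,1]$ is the class of graphs admitting a VPT representation whose host tree has maximum degree at most $h$. A minimal non $[h,2,1]$ graph is a graph $G\notin[h,2,1]$ with $G-v\in[h,2,1]$ for all $v\in V(G)$. A clique is a maximal complete set; $\mathcal{C}(G)$ is the set of cliques. $N(v)$ is the open neighborhood. For $C\in\mathcal{C}(G)$, the branch graph $B(G/C)$ has as vertices the vertices of $V(G)\setminus C$ adjacent to some vertex of $C$, and $v,w$ are adjacent in $B(G/C)$ iff $vw\notin E(G)$, some $x\in C$ is adjacent to both, some $y\in C$ is adjacent to $v$ but not $w$, and some $z\in C$ is adjacent to $w$ but not $v$. A clique $K$ is principal if $\max_{C\in\mathcal{C}(G)}\chi(B(G/C))=\chi(B(G/K))$. A graph $H$ with $\chi(H)=k$ is $k$-vertex critical if $\chi(H-v)<\chi(H)$ for every vertex $v$. *)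

theory Defs
  imports "Graph_Theory.Digraph_Component"
begin

text \<open>
  Finite simple graphs are the symmetric, loop-free, finite digraphs without parallel arcs of the
  locale \<open>graph\<close>; \<open>u \<rightarrow>\<^bsub>G\<^esub> v\<close> is then the (symmetric) adjacency relation. Connectedness is not part
  of the definitions below, since deleting a vertex may disconnect a graph.
\<close>

definition nbhd :: "('a, 'b) pre_digraph \<Rightarrow> 'a \<Rightarrow> 'a set" where
  "nbhd G v = {u. v \<rightarrow>\<^bsub>G\<^esub> u}"

definition complete_set :: "('a, 'b) pre_digraph \<Rightarrow> 'a set \<Rightarrow> bool" where
  "complete_set G C \<longleftrightarrow> C \<subseteq> verts G \<and> (\<forall>u\<in>C. \<forall>v\<in>C. u \<noteq> v \<longrightarrow> u \<rightarrow>\<^bsub>G\<^esub> v)"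

definition cliques :: "('a, 'b) pre_digraph \<Rightarrow> 'a set set" where
  "cliques G = {C. complete_set G C \<and> (\<forall>D. complete_set G D \<and> C \<subseteq> D \<longrightarrow> D = C)}"

text \<open>
  In a symmetric digraph every edge yields the two-arc cycle \<open>u \<rightarrow> v \<rightarrow> u\<close>, so the library predicate
  \<open>tree\<close> is not the undirected notion. As there are neither loops nor parallel arcs, the cycles of
  length at least 3 are exactly the undirected cycles. The library's \<open>connected\<close> requires a
  nonempty vertex set.
\<close>

definition utree :: "('t, 'e) pre_digraph \<Rightarrow> bool" where
  "utree T \<longleftrightarrow> graph T \<and> connected T \<and> \<not> (\<exists>p. pre_digraph.cycle T p \<and> length p \<ge> 3)"

text \<open>Paths are given by their vertex sets; one-vertex paths are allowed.\<close>

definition vpaths :: "('t, 'e) pre_digraph \<Rightarrow> 't set set" where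
  "vpaths T = {set (pre_digraph.awalk_verts T x p) | x p y. pre_digraph.apath T x p y}"

definition vpt_representation ::
    "('a, 'b) pre_digraph \<Rightarrow> ('t, 'e) pre_digraph \<Rightarrow> ('a \<Rightarrow> 't set) \<Rightarrow> bool" where
  "vpt_representation G T P \<longleftrightarrow>
     utree T \<and> (\<forall>v\<in>verts G. P v \<in> vpaths T) \<and>
     (\<forall>u\<in>verts G. \<forall>v\<in>verts G. u \<noteq> v \<longrightarrow> (u \<rightarrow>\<^bsub>G\<^esub> v \<longleftrightarrow> P u \<inter> P v \<noteq> {}))"

text \<open>
  Host trees are finite, so taking natural numbers as their vertices and pairs as their arcs loses
  no generality. In a symmetric digraph the degree of a vertex is its out-degree.
\<close>

definition VPT :: "('a, 'b) pre_digraph \<Rightarrow> bool" where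
  "VPT G \<longleftrightarrow> (\<exists>(T :: (nat, nat \<times> nat) pre_digraph) P. vpt_representation G T P)"

definition in_h21 :: "nat \<Rightarrow> ('a, 'b) pre_digraph \<Rightarrow> bool" where
  "in_h21 h G \<longleftrightarrow> (\<exists>(T :: (nat, nat \<times> nat) pre_digraph) P.
     vpt_representation G T P \<and> (\<forall>x\<in>verts T. out_degree T x \<le> h))"

definition minimal_non_h21 :: "nat \<Rightarrow> ('a, 'b) pre_digraph \<Rightarrow> bool" where
  "minimal_non_h21 h G \<longleftrightarrow>
     \<not> in_h21 h G \<and> (\<forall>v\<in>verts G. in_h21 h (pre_digraph.del_vert G v))"

definition branch_verts :: "('a, 'b) pre_digraph \<Rightarrow> 'a set \<Rightarrow> 'a set" where
  "branch_verts G C = {v \<in> verts G - C. \<exists>x\<in>C. v \<rightarrow>\<^bsub>G\<^esub> x}"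

definition branch_graph :: "('a, 'b) pre_digraph \<Rightarrow> 'a set \<Rightarrow> ('a, 'a \<times> 'a) pre_digraph" where
  "branch_graph G C = with_proj
     \<lparr> pverts = branch_verts G C,
       parcs = {(v, w). v \<in> branch_verts G C \<and> w \<in> branch_verts G C \<and> \<not> v \<rightarrow>\<^bsub>G\<^esub> w \<and>
         (\<exists>x\<in>C. x \<rightarrow>\<^bsub>G\<^esub> v \<and> x \<rightarrow>\<^bsub>G\<^esub> w) \<and>
         (\<exists>y\<in>C. y \<rightarrow>\<^bsub>G\<^esub> v \<and> \<not> y \<rightarrow>\<^bsub>G\<^esub> w) \<and>
         (\<exists>z\<in>C. z \<rightarrow>\<^bsub>G\<^esub> w \<and> \<not> z \<rightarrow>\<^bsub>G\<^esub> v)} \<rparr>"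

definition proper_coloring :: "('a, 'b) pre_digraph \<Rightarrow> nat \<Rightarrow> ('a \<Rightarrow> nat) \<Rightarrow> bool" where
  "proper_coloring H k c \<longleftrightarrow>
     (\<forall>v\<in>verts H. c v < k) \<and> (\<forall>u v. u \<rightarrow>\<^bsub>H\<^esub> v \<longrightarrow> c u \<noteq> c v)"

definition chromatic_number :: "('a, 'b) pre_digraph \<Rightarrow> nat" where
  "chromatic_number H = (LEAST k. \<exists>c. proper_coloring H k c)"

definition vertex_critical :: "nat \<Rightarrow> ('a, 'b) pre_digraph \<Rightarrow> bool" where
  "vertex_critical k H \<longleftrightarrow> chromatic_number H = k \<and>
     (\<forall>v\<in>verts H. chromatic_number (pre_digraph.del_vert H v) < chromatic_number H)"

definition principal_clique :: "('a, 'b) pre_digraph \<Rightarrow> 'a set \<Rightarrow> bool" where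
  "principal_clique G K \<longleftrightarrow> K \<in> cliques G \<and>
     (MAX C\<in>cliques G. chromatic_number (branch_graph G C)) = chromatic_number (branch_graph G K)"

end

theory Submission
  imports Defs
begin

text \<open>
  Everything rests on the fact that, for \<open>h \<ge> 3\<close>, a VPT graph lies in \<open>[h,2,1]\<close> iff
  all its branch graphs are \<open>h\<close>-colourable. Given a host tree of maximum degree \<open>h\<close>, the paths of a
  clique \<open>C\<close> share a node \<open>q\<close>, and colouring each vertex outside \<open>C\<close> by the direction from \<open>q\<close> to its
  path colours \<open>B(G/C)\<close>, because the neighbourhoods in \<open>C\<close> of two vertices hit by a common path in the
  same direction are nested. Conversely, contract edges of a host tree as long as the intersection
  pattern allows it. Then the paths through a node \<open>q\<close> form a clique, every direction at \<open>q\<close> is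
  witnessed by a path avoiding \<open>q\<close>, and a colouring of the branch graph yields a colouring of the
  directions at \<open>q\<close> in which no path joins two directions of the same colour. If \<open>q\<close> has more than \<open>h\<close>
  neighbours, two of them have the same colour and can be moved to a new neighbour of \<open>q\<close> of degree 3.

  Hence \<open>B(G/K)\<close> is not \<open>h\<close>-colourable, whereas deleting any vertex \<open>v\<close> outside \<open>K\<close> from \<open>G\<close> makes it
  so. A colouring of \<open>B(G/K) - v\<close> would extend to \<open>v\<close> if \<open>v\<close> were missing from \<open>B(G/K)\<close>, had a single
  neighbour in \<open>K\<close> (then it is isolated), or had the same neighbours in \<open>K\<close> as some other \<open>w\<close> (then every
  neighbour of \<open>v\<close> in \<open>B(G/K)\<close> is one of \<open>w\<close>).
\<close>

section \<open>Trees given by cuts\<close>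

text \<open>In a tree the nodes of \<open>S\<close> are exactly those on the side of
  \<open>u\<close> once the edge \<open>uv\<close> is removed. Elements outside the node set are
  allowed in \<open>S\<close>, so that complements of cuts are again cuts.\<close>

definition edge_cut :: "('t \<times> 't) set \<Rightarrow> 't \<Rightarrow> 't \<Rightarrow> 't set \<Rightarrow> bool" where
  "edge_cut E u v S \<longleftrightarrow> u \<in> S \<and> v \<notin> S \<and> (\<forall>x y. (x, y) \<in> E \<and> x \<in> S \<and> y \<notin> S \<longrightarrow> x = u \<and> y = v)"

definition conn :: "('t \<times> 't) set \<Rightarrow> 't set \<Rightarrow> bool" where
  "conn E P \<longleftrightarrow> (\<forall>x\<in>P. \<forall>y\<in>P. (x, y) \<in> (E \<inter> P \<times> P)\<^sup>*)"

text \<open>Convexity is phrased by cuts rather than by paths. In this form it passes to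
  intersections at once, and connected sets have it because a walk can change sides only over the
  edge of the cut.\<close>

definition convex_in :: "('t \<times> 't) set \<Rightarrow> 't set \<Rightarrow> bool" where
  "convex_in E P \<longleftrightarrow> (\<forall>x\<in>P. \<forall>y\<in>P. \<forall>u v S.
     (u, v) \<in> E \<and> edge_cut E u v S \<and> x \<in> S \<and> y \<notin> S \<longrightarrow> u \<in> P \<and> v \<in> P)"

lemma convex_inD:
  "convex_in E P \<Longrightarrow> (u, v) \<in> E \<Longrightarrow> edge_cut E u v S \<Longrightarrow> x \<in> P \<Longrightarrow> y \<in> P \<Longrightarrow> x \<in> S \<Longrightarrow> y \<notin> S
    \<Longrightarrow> u \<in> P \<and> v \<in> P"
  unfolding convex_in_def by blast

lemma convex_inI:
  assumes "\<And>u v S x y. (u, v) \<in> E \<Longrightarrow> edge_cut E u v S \<Longrightarrow> x \<in> P \<Longrightarrow> y \<in> P \<Longrightarrow> x \<in> S \<Longrightarrow> y \<notin> S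
    \<Longrightarrow> u \<in> P \<and> v \<in> P"
  shows "convex_in E P"
  unfolding convex_in_def using assms by blast

definition path_list :: "('t \<times> 't) set \<Rightarrow> 't list \<Rightarrow> bool" where
  "path_list E xs \<longleftrightarrow> xs \<noteq> [] \<and> distinct xs \<and> (\<forall>i. Suc i < length xs \<longrightarrow> (xs ! i, xs ! Suc i) \<in> E)"

definition path_in :: "('t \<times> 't) set \<Rightarrow> 't set \<Rightarrow> bool" where
  "path_in E P \<longleftrightarrow> (\<exists>xs. path_list E xs \<and> set xs = P)"

text \<open>A finite nonempty connected set of tree nodes that is narrow is a path. Unlike a node
  list, this description is easily carried through contractions and splittings.\<close>

definition narrow :: "('t \<times> 't) set \<Rightarrow> 't set \<Rightarrow> bool" where
  "narrow E P \<longleftrightarrow> (\<forall>x\<in>P. \<forall>a\<in>P. \<forall>b\<in>P. \<forall>c\<in>P. (x, a) \<in> E \<and> (x, b) \<in> E \<and> (x, c) \<in> E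
     \<longrightarrow> a = b \<or> b = c \<or> a = c)"

text \<open>Acyclicity is expressed by requiring each edge to be the only one leaving some set of nodes.\<close>

locale host_tree =
  fixes V :: "'t set" and E :: "('t \<times> 't) set"
  assumes finV: "finite V" and neV: "V \<noteq> {}" and EV: "E \<subseteq> V \<times> V"
    and symE: "(u, v) \<in> E \<Longrightarrow> (v, u) \<in> E" and irrE: "(u, u) \<notin> E"
    and reach: "u \<in> V \<Longrightarrow> v \<in> V \<Longrightarrow> (u, v) \<in> E\<^sup>*"
    and cuts: "(u, v) \<in> E \<Longrightarrow> \<exists>S. edge_cut E u v S"

lemma convex_Int: "convex_in E P \<Longrightarrow> convex_in E Q \<Longrightarrow> convex_in E (P \<inter> Q)"
  by (rule convex_inI) (auto dest: convex_inD)

lemma rtrancl_crosses: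
  assumes "(x, y) \<in> (E \<inter> P \<times> P)\<^sup>*" "x \<in> S" "y \<notin> S" "edge_cut E u v S"
  shows "u \<in> P \<and> v \<in> P"
  using assms(1,3)
proof (induction rule: rtrancl_induct)
  case base
  then show ?case using assms by simp
next
  case (step y z)
  then show ?case using assms(4) unfolding edge_cut_def by blast
qed

lemma conn_convex: "conn E P \<Longrightarrow> convex_in E P"
  by (rule convex_inI) (auto simp: conn_def dest: rtrancl_crosses)

text \<open>The exit is taken at the last visit to \<open>I\<close>, so that the rest of the walk
  avoids \<open>u\<close> and stays on the far side of any cut of the edge
  \<open>uv\<close>.\<close>

lemma rtrancl_last_exit:
  assumes "(i, p) \<in> E\<^sup>*" "i \<in> I" "p \<notin> I"
  shows "\<exists>u v. u \<in> I \<and> v \<notin> I \<and> (u, v) \<in> E \<and> (v, p) \<in> (E \<inter> (- I) \<times> (- I))\<^sup>*"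
  using assms(1,3)
proof (induction rule: rtrancl_induct)
  case base
  then show ?case using assms by simp
next
  case (step y z)
  show ?case
  proof (cases "y \<in> I")
    case True
    then show ?thesis using step by blast
  next
    case False
    then obtain u v where "u \<in> I \<and> v \<notin> I \<and> (u, v) \<in> E \<and> (v, y) \<in> (E \<inter> (- I) \<times> (- I))\<^sup>*"
      using step by blast
    moreover have "(y, z) \<in> E \<inter> (- I) \<times> (- I)" using step False by simp
    ultimately show ?thesis by (meson rtrancl.rtrancl_into_rtrancl)
  qed
qed

lemma conn_edgeI:
  assumes "(u, v) \<in> E" "(v, u) \<in> E"
  shows "conn E {u, v}"
  using assms unfolding conn_def by (auto intro!: r_into_rtrancl)

section \<open>Separation and the Helly property of subtrees\<close>

context host_tree
begin

lemma edge_cut_sym: "edge_cut E u v S \<Longrightarrow> edge_cut E v u (- S)"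
  unfolding edge_cut_def using symE by blast

text \<open>The edge \<open>uv\<close> is the last exit from \<open>I\<close> on a walk from
  \<open>I\<close> to \<open>P\<close>. If \<open>I\<close> left \<open>S\<close>, convexity would
  put \<open>v\<close> into \<open>I\<close>. The walk from \<open>v\<close> on avoids
  \<open>u\<close>, so it ends outside \<open>S\<close>. If \<open>P\<close> met \<open>S\<close>,
  convexity would put \<open>u\<close> into \<open>P\<close>, against disjointness.\<close>

lemma separation:
  assumes I: "convex_in E I" "I \<noteq> {}" "I \<subseteq> V" and P: "convex_in E P" "P \<noteq> {}" "P \<subseteq> V"
    and disj: "I \<inter> P = {}"
  obtains u v S where "(u, v) \<in> E" "edge_cut E u v S" "u \<in> I" "v \<notin> I" "I \<subseteq> S" "P \<inter> S = {}"
proof -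
  obtain i p where ip: "i \<in> I" "p \<in> P" using I P by blast
  then have "(i, p) \<in> E\<^sup>*" "p \<notin> I" using reach I P disj by blast+
  then obtain u v where uv: "u \<in> I" "v \<notin> I" "(u, v) \<in> E" "(v, p) \<in> (E \<inter> (- I) \<times> (- I))\<^sup>*"
    using rtrancl_last_exit[of i p E I] ip by blast
  obtain S where S: "edge_cut E u v S" using cuts uv by blast
  then have S': "u \<in> S" "v \<notin> S" unfolding edge_cut_def by auto
  have "I \<subseteq> S" using convex_inD[OF I(1) uv(3) S uv(1)] S' uv by blast
  moreover have "p \<notin> S"
    using rtrancl_crosses[OF uv(4) _ _ edge_cut_sym[OF S]] S' uv(1) by blast
  then have "P \<inter> S = {}" using convex_inD[OF P(1) uv(3) S] uv ip disj by blast
  ultimately show thesis using that uv S by blast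
qed

text \<open>Induction over the family. If the intersection of the old members missed the new set
  \<open>P\<close>, an edge \<open>uv\<close> would separate them, with \<open>u\<close> in the
  intersection. Each old member contains \<open>u\<close> and meets \<open>P\<close> beyond the
  edge, hence contains \<open>v\<close>; so \<open>v\<close> would lie in the intersection as
  well.\<close>

lemma helly:
  assumes "finite F" "F \<noteq> {}" "\<And>Q. Q \<in> F \<Longrightarrow> convex_in E Q \<and> Q \<subseteq> V \<and> Q \<noteq> {}"
    and "\<And>Q R. Q \<in> F \<Longrightarrow> R \<in> F \<Longrightarrow> Q \<inter> R \<noteq> {}"
  shows "\<Inter>F \<noteq> {}"
proof -
  have "convex_in E (\<Inter>F) \<and> \<Inter>F \<noteq> {} \<and> \<Inter>F \<subseteq> V"
    using assms
  proof (induction rule: finite_ne_induct)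
    case (singleton Q)
    then show ?case by auto
  next
    case (insert P F)
    then have I: "convex_in E (\<Inter>F)" "\<Inter>F \<noteq> {}" "\<Inter>F \<subseteq> V" by simp_all
    have P: "convex_in E P" "P \<noteq> {}" "P \<subseteq> V" using insert.prems(1)[of P] by simp_all
    have "\<Inter>F \<inter> P \<noteq> {}"
    proof
      assume e: "\<Inter>F \<inter> P = {}"
      obtain u v S where s: "(u, v) \<in> E" "edge_cut E u v S" "u \<in> \<Inter>F" "v \<notin> \<Inter>F" "\<Inter>F \<subseteq> S" "P \<inter> S = {}"
        using separation[OF I P e] by metis
      have "v \<in> Q" if Q: "Q \<in> F" for Q
      proof -
        have "Q \<inter> P \<noteq> {}" using insert.prems(2)[of Q P] Q by simp
        then obtain y where y: "y \<in> Q" "y \<in> P" by (meson disjoint_iff)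
        have u: "u \<in> Q" "u \<in> S" using s(3,5) Q by (auto simp only: Inter_iff subset_iff)
        have c: "convex_in E Q" using insert.prems(1)[of Q] Q by simp
        show ?thesis using convex_inD[OF c s(1,2) u(1) y(1) u(2)] s(6) y(2) by auto
      qed
      then show False using s(4) by simp
    qed
    moreover have "convex_in E (\<Inter>F \<inter> P)" by (rule convex_Int[OF I(1) P(1)])
    ultimately show ?case using I(3) by (simp add: Int_commute le_infI2)
  qed
  then show ?thesis by simp
qed

text \<open>A walk from a node of \<open>S\<close> to \<open>v\<close> can leave \<open>S\<close>
  only at \<open>u\<close>, so up to that moment it links the node to \<open>u\<close> inside
  \<open>S\<close>.\<close>

lemma conn_cut_side:
  assumes S: "edge_cut E u v S" and uv: "(u, v) \<in> E"
  shows "conn E (S \<inter> V)"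
proof -
  let ?R = "E \<inter> (S \<inter> V) \<times> (S \<inter> V)"
  have toU: "(z, u) \<in> ?R\<^sup>*" if "(z, v) \<in> E\<^sup>*" "z \<in> S" for z
    using that
  proof (induction rule: converse_rtrancl_induct)
    case base
    then show ?case using S unfolding edge_cut_def by blast
  next
    case (step y z)
    show ?case
    proof (cases "z \<in> S")
      case True
      then have "(y, z) \<in> ?R" using step EV by blast
      then show ?thesis using step True by (meson converse_rtrancl_into_rtrancl)
    next
      case False
      then have "y = u" using S step unfolding edge_cut_def by blast
      then show ?thesis by simp
    qed
  qed
  have "sym ?R" using symE unfolding sym_def by blast
  then have "sym (?R\<^sup>*)" by (rule sym_rtrancl)
  moreover have "v \<in> V" using uv EV by blast
  ultimately show ?thesis unfolding conn_def using toU reach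
    by (meson IntE rtrancl_trans symD)
qed

section \<open>Paths as lists and as connected narrow sets\<close>

lemma path_list_between:
  assumes xs: "path_list E xs" and ijk: "i \<le> j" "j \<le> k" "k < length xs"
    and Q: "convex_in E Q" "xs ! i \<in> Q" "xs ! k \<in> Q"
  shows "xs ! j \<in> Q"
proof (cases "j = k")
  case True
  then show ?thesis using Q by simp
next
  case False
  let ?u = "xs ! j" and ?v = "xs ! Suc j"
  have adj: "(xs ! m, xs ! Suc m) \<in> E" if "m < k" for m
    using xs ijk that unfolding path_list_def by simp
  have inj: "xs ! m = xs ! n \<Longrightarrow> m = n" if "m \<le> k" "n \<le> k" for m n
    using xs ijk that unfolding path_list_def by (simp add: nth_eq_iff_index_eq)
  have uv: "(?u, ?v) \<in> E" using adj ijk False by simp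
  obtain S where S: "edge_cut E ?u ?v S" using cuts uv by blast
  note S' = edge_cut_sym[OF S]
  \<comment> \<open>The cut of the edge after position \<open>j\<close> splits the list: going back
    from \<open>j\<close>, or forward from \<open>j + 1\<close>, the list could change sides only
    over this edge, and that would repeat a node.\<close>
  have "xs ! m \<in> S" if "m \<le> j" for m
    using that
  proof (induction rule: inc_induct)
    case base
    then show ?case using S unfolding edge_cut_def by blast
  next
    case (step n)
    have e: "(xs ! Suc n, xs ! n) \<in> E" using adj[of n] symE step ijk by simp
    show ?case
    proof (rule ccontr)
      assume "xs ! n \<notin> S"
      then have "xs ! Suc n = ?u" "xs ! n = ?v" using S e step unfolding edge_cut_def by blast+
      then show False using inj[of n "Suc j"] step ijk False by simp
    qed
  qed
  then have "xs ! i \<in> S" using ijk by simp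
  moreover have "xs ! m \<notin> S" if "Suc j \<le> m" "m \<le> k" for m
    using that
  proof (induction rule: dec_induct)
    case base
    then show ?case using S unfolding edge_cut_def by blast
  next
    case (step n)
    have e: "(xs ! n, xs ! Suc n) \<in> E" using adj[of n] step by simp
    show ?case
    proof
      assume "xs ! Suc n \<in> S"
      then have "xs ! Suc n = ?u" using S symE[OF e] step unfolding edge_cut_def by auto
      then show False using inj[of "Suc n" j] step by simp
    qed
  qed
  then have "xs ! k \<notin> S" using False ijk by simp
  ultimately show ?thesis using convex_inD[OF Q(1) uv S Q(2,3)] by blast
qed

text \<open>Among three positions of a list one is in the middle. Betweenness is recorded through
  convex sets, so that the list can be forgotten.\<close>

lemma path_in_between:
  assumes P: "path_in E P" and xyz: "x \<in> P" "y \<in> P" "z \<in> P"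
  obtains "\<And>Q. convex_in E Q \<Longrightarrow> y \<in> Q \<Longrightarrow> z \<in> Q \<Longrightarrow> x \<in> Q"
  | "\<And>Q. convex_in E Q \<Longrightarrow> x \<in> Q \<Longrightarrow> z \<in> Q \<Longrightarrow> y \<in> Q"
  | "\<And>Q. convex_in E Q \<Longrightarrow> x \<in> Q \<Longrightarrow> y \<in> Q \<Longrightarrow> z \<in> Q"
proof -
  obtain xs where xs: "path_list E xs" "set xs = P" using P unfolding path_in_def by blast
  obtain i j k where ijk: "x = xs ! i" "y = xs ! j" "z = xs ! k"
    "i < length xs" "j < length xs" "k < length xs"
    using xyz xs(2) by (metis in_set_conv_nth)
  note b = path_list_between[OF xs(1)]
  consider "j \<le> i \<and> i \<le> k \<or> k \<le> i \<and> i \<le> j" | "i \<le> j \<and> j \<le> k \<or> k \<le> j \<and> j \<le> i"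
    | "i \<le> k \<and> k \<le> j \<or> j \<le> k \<and> k \<le> i" by linarith
  then show thesis
  proof cases
    case 1
    show ?thesis
    proof (rule that(1))
      fix Q assume "convex_in E Q" "y \<in> Q" "z \<in> Q"
      then show "x \<in> Q" using 1 ijk b[of j i k Q] b[of k i j Q] by auto
    qed
  next
    case 2
    show ?thesis
    proof (rule that(2))
      fix Q assume "convex_in E Q" "x \<in> Q" "z \<in> Q"
      then show "y \<in> Q" using 2 ijk b[of i j k Q] b[of k j i Q] by auto
    qed
  next
    case 3
    show ?thesis
    proof (rule that(3))
      fix Q assume "convex_in E Q" "x \<in> Q" "y \<in> Q"
      then show "z \<in> Q" using 3 ijk b[of i k j Q] b[of j k i Q] by auto
    qed
  qed
qed

lemma path_list_conn:
  assumes xs: "path_list E xs"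
  shows "conn E (set xs)"
proof -
  let ?R = "E \<inter> set xs \<times> set xs"
  have "(xs ! i, xs ! j) \<in> ?R\<^sup>*" if "i \<le> j" "j < length xs" for i j
    using that
  proof (induction rule: dec_induct)
    case (step n)
    then have "(xs ! n, xs ! Suc n) \<in> ?R" using xs unfolding path_list_def by simp
    then show ?case using step by (meson Suc_lessD rtrancl.rtrancl_into_rtrancl)
  qed simp
  moreover have "sym (?R\<^sup>*)" using symE by (intro sym_rtrancl) (auto simp: sym_def)
  ultimately show ?thesis unfolding conn_def
    by (metis in_set_conv_nth nle_le symD)
qed

text \<open>There are no chords: the two ends of an edge form a convex set, which contains all
  entries between them. So an entry is adjacent at most to its predecessor and its
  successor.\<close>

lemma path_list_narrow:
  assumes xs: "path_list E xs"
  shows "narrow E (set xs)"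
proof -
  have inj: "xs ! m = xs ! n \<longleftrightarrow> m = n" if "m < length xs" "n < length xs" for m n
    using xs that unfolding path_list_def by (simp add: nth_eq_iff_index_eq)
  have chord: "j = Suc i" if "i < j" "j < length xs" "(xs ! i, xs ! j) \<in> E" for i j
  proof -
    have "convex_in E {xs ! i, xs ! j}" using that(3) by (simp add: conn_convex conn_edgeI symE)
    then have "xs ! Suc i \<in> {xs ! i, xs ! j}"
      using path_list_between[OF xs, of i "Suc i" j "{xs ! i, xs ! j}"] that by simp
    then show ?thesis using inj[of "Suc i" i] inj[of "Suc i" j] that by simp
  qed
  have nb: "j = Suc i \<or> i = Suc j" if "i < length xs" "j < length xs" "(xs ! i, xs ! j) \<in> E" for i j
    using chord[of i j] chord[of j i] symE that irrE by (metis linorder_neqE_nat)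
  show ?thesis unfolding narrow_def
  proof (intro ballI impI)
    fix x a b c assume "x \<in> set xs" "a \<in> set xs" "b \<in> set xs" "c \<in> set xs"
      and e: "(x, a) \<in> E \<and> (x, b) \<in> E \<and> (x, c) \<in> E"
    then obtain i j k l where "x = xs ! i" "a = xs ! j" "b = xs ! k" "c = xs ! l"
      "i < length xs" "j < length xs" "k < length xs" "l < length xs" by (metis in_set_conv_nth)
    then show "a = b \<or> b = c \<or> a = c" using nb[of i j] nb[of i k] nb[of i l] e by auto
  qed
qed

text \<open>A longest path inside \<open>P\<close> exhausts \<open>P\<close>. Otherwise an edge
  leads from an entry \<open>u\<close> to a node \<open>v\<close> of \<open>P\<close> off the path;
  at either end of the path \<open>v\<close> could be attached, and at an inner entry it would be a
  third neighbour of \<open>u\<close>.\<close>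

lemma narrow_path_in:
  assumes P: "conn E P" "narrow E P" "finite P" "P \<noteq> {}"
  shows "path_in E P"
proof -
  let ?A = "{xs. path_list E xs \<and> set xs \<subseteq> P}"
  obtain p where p: "p \<in> P" using P by blast
  have pA: "[p] \<in> ?A" using p by (simp add: path_list_def)
  have bd: "\<forall>xs. xs \<in> ?A \<longrightarrow> length xs < Suc (card P)"
  proof (intro allI impI)
    fix xs assume "xs \<in> ?A"
    then have "distinct xs" "set xs \<subseteq> P" unfolding path_list_def by auto
    then show "length xs < Suc (card P)" using card_mono[OF P(3)] distinct_card by (metis le_imp_less_Suc)
  qed
  obtain xs where xs: "xs \<in> ?A" and mx: "\<And>ys. ys \<in> ?A \<Longrightarrow> length ys \<le> length xs"
    using ex_has_greatest_nat[OF pA bd] by blast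
  have pl: "path_list E xs" and sub: "set xs \<subseteq> P" using xs by auto
  have ne: "xs \<noteq> []" and dist: "distinct xs"
    and adj: "\<And>i. Suc i < length xs \<Longrightarrow> (xs ! i, xs ! Suc i) \<in> E"
    using pl unfolding path_list_def by auto
  have "set xs = P"
  proof (rule ccontr)
    assume "set xs \<noteq> P"
    then obtain z where z: "z \<in> P" "z \<notin> set xs" using sub by blast
    have "(hd xs, z) \<in> (E \<inter> P \<times> P)\<^sup>*" using P(1) z hd_in_set[OF ne] sub unfolding conn_def by blast
    then obtain u v where uv: "u \<in> set xs" "v \<notin> set xs" "(u, v) \<in> E" "v \<in> P"
      using rtrancl_last_exit[of "hd xs" z "E \<inter> P \<times> P" "set xs"] z ne by auto
    then obtain i where i: "i < length xs" "u = xs ! i" by (metis in_set_conv_nth)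
    show False
    proof (cases "i = 0")
      case True
      have "path_list E (v # xs)"
        unfolding path_list_def
      proof (intro conjI allI impI)
        fix j assume "Suc j < length (v # xs)"
        then show "((v # xs) ! j, (v # xs) ! Suc j) \<in> E"
          using adj uv i True symE by (cases j) auto
      qed (use dist uv in auto)
      then have "v # xs \<in> ?A" using uv sub by simp
      then show False using mx[of "v # xs"] by simp
    next
      case False
      show False
      proof (cases "Suc i = length xs")
        case True
        have "path_list E (xs @ [v])"
          unfolding path_list_def
        proof (intro conjI allI impI)
          fix j assume "Suc j < length (xs @ [v])"
          then show "((xs @ [v]) ! j, (xs @ [v]) ! Suc j) \<in> E"
            using adj uv(3) i True by (cases "j = i") (auto simp: nth_append)
        qed (use dist uv in auto)
        then have "xs @ [v] \<in> ?A" using uv sub by simp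
        then show False using mx[of "xs @ [v]"] by simp
      next
        case False
        then have l: "Suc i < length xs" using i by simp
        let ?p = "xs ! (i - 1)" and ?n = "xs ! Suc i"
        have "(?p, u) \<in> E" using adj[of "i - 1"] \<open>i \<noteq> 0\<close> i by simp
        then have "(u, ?p) \<in> E" by (rule symE)
        moreover have "(u, ?n) \<in> E" using adj[of i] i l by simp
        moreover have "?p \<noteq> ?n" using dist l \<open>i \<noteq> 0\<close> by (simp add: nth_eq_iff_index_eq)
        moreover have "?p \<in> set xs" "?n \<in> set xs" using l by auto
        ultimately have "?p = v \<or> ?n = v"
          using P(2) uv sub unfolding narrow_def by (metis subsetD)
        then show False using uv \<open>?p \<in> set xs\<close> \<open>?n \<in> set xs\<close> by blast
      qed
    qed
  qed
  then show ?thesis using pl unfolding path_in_def by blast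
qed

lemma path_in_conn: "path_in E P \<Longrightarrow> conn E P"
  unfolding path_in_def using path_list_conn by blast

lemma path_in_narrow: "path_in E P \<Longrightarrow> narrow E P"
  unfolding path_in_def using path_list_narrow by blast

lemma path_in_convex: "path_in E P \<Longrightarrow> convex_in E P"
  using path_in_conn conn_convex by blast

lemma path_in_finite: "path_in E P \<Longrightarrow> finite P \<and> P \<noteq> {}"
  unfolding path_in_def path_list_def by auto

text \<open>Each of the paths \<open>X\<close>, \<open>Y\<close>, \<open>Z\<close> leaves \<open>q\<close> towards \<open>a\<close>; the points where \<open>X\<close> enters \<open>R\<close>
  and \<open>W\<close> are comparable on \<open>X\<close>, and whoever reaches the farther one passes through the nearer one.\<close>

lemma same_branch_nested:
  assumes qa: "(q, a) \<in> E" "edge_cut E q a S"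
    and R: "convex_in E R" "R \<subseteq> V" "R \<inter> S = {}" and W: "convex_in E W" "W \<subseteq> V" "W \<inter> S = {}"
    and X: "path_in E X" "q \<in> X" "X \<inter> R \<noteq> {}" "X \<inter> W \<noteq> {}"
    and Y: "convex_in E Y" "q \<in> Y" "Y \<inter> R \<noteq> {}"
    and Z: "convex_in E Z" "q \<in> Z" "Z \<inter> W \<noteq> {}"
  shows "Y \<inter> W \<noteq> {} \<or> Z \<inter> R \<noteq> {}"
proof -
  have qS: "q \<in> S" "a \<notin> S" using qa(2) unfolding edge_cut_def by auto
  have qV: "q \<in> V" using qa EV by blast
  have q1: "convex_in E {q}" by (rule convex_inI) auto
  \<comment> \<open>\<open>r\<close> is the node of \<open>R\<close> nearest to \<open>q\<close>:
    the edge separating \<open>R\<close> from \<open>q\<close> starts at \<open>r\<close>, and every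
    convex set that joins \<open>q\<close> to \<open>R\<close> has to use it.\<close>
  have gate: "\<exists>r\<in>R. \<forall>Q. convex_in E Q \<and> q \<in> Q \<and> Q \<inter> R \<noteq> {} \<longrightarrow> r \<in> Q"
    if R: "convex_in E R" "R \<subseteq> V" "R \<inter> S = {}" "R \<noteq> {}" for R
  proof -
    obtain r r' T where r: "(r, r') \<in> E" "edge_cut E r r' T" "r \<in> R" "R \<subseteq> T" "{q} \<inter> T = {}"
      using separation[OF R(1,4,2) q1, of thesis] R(3) qS(1) qV by blast
    then have "r \<in> Q" if "convex_in E Q" "q \<in> Q" "Q \<inter> R \<noteq> {}" for Q
      using convex_inD[OF that(1) r(1,2), of _ q] that r by blast
    then show ?thesis using r by blast
  qed
  obtain r where r: "r \<in> R" "\<And>Q. convex_in E Q \<Longrightarrow> q \<in> Q \<Longrightarrow> Q \<inter> R \<noteq> {} \<Longrightarrow> r \<in> Q"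
    using gate[OF R] X by blast
  obtain w where w: "w \<in> W" "\<And>Q. convex_in E Q \<Longrightarrow> q \<in> Q \<Longrightarrow> Q \<inter> W \<noteq> {} \<Longrightarrow> w \<in> Q"
    using gate[OF W] X by blast
  have Xc: "convex_in E X" using X path_in_convex by blast
  have in_X: "r \<in> X" "w \<in> X" using r(2) w(2) Xc X by blast+
  \<comment> \<open>The branch at \<open>a\<close> is convex and contains \<open>r\<close> and
    \<open>w\<close> but not \<open>q\<close>, so \<open>q\<close> is not the middle one of the
    three nodes.\<close>
  have br: "convex_in E (- S \<inter> V)"
    using conn_convex conn_cut_side[OF edge_cut_sym[OF qa(2)] symE[OF qa(1)]] by blast
  show ?thesis
  proof (rule path_in_between[OF X(1) X(2) in_X])
    assume "\<And>Q. convex_in E Q \<Longrightarrow> r \<in> Q \<Longrightarrow> w \<in> Q \<Longrightarrow> q \<in> Q"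
    then show ?thesis using br r(1) w(1) R W qS by blast
  next
    assume "\<And>Q. convex_in E Q \<Longrightarrow> q \<in> Q \<Longrightarrow> w \<in> Q \<Longrightarrow> r \<in> Q"
    then show ?thesis using w(2)[OF Z] Z r(1) by blast
  next
    assume "\<And>Q. convex_in E Q \<Longrightarrow> q \<in> Q \<Longrightarrow> r \<in> Q \<Longrightarrow> w \<in> Q"
    then show ?thesis using r(2)[OF Y] Y w(1) by blast
  qed
qed

end

section \<open>Contracting an edge of the host tree\<close>

text \<open>The graph enters only as a vertex set with an adjacency relation, so that the host tree
  can be rebuilt while the graph stays fixed.\<close>

definition model :: "'a set \<Rightarrow> ('a \<Rightarrow> 'a \<Rightarrow> bool) \<Rightarrow> 't set \<Rightarrow> ('t \<times> 't) set \<Rightarrow> ('a \<Rightarrow> 't set) \<Rightarrow> bool" where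
  "model U A V E P \<longleftrightarrow> host_tree V E \<and>
     (\<forall>u\<in>U. P u \<subseteq> V \<and> P u \<noteq> {} \<and> conn E (P u) \<and> narrow E (P u)) \<and>
     (\<forall>u\<in>U. \<forall>v\<in>U. u \<noteq> v \<longrightarrow> (A u v \<longleftrightarrow> P u \<inter> P v \<noteq> {}))"

definition merge :: "'t \<Rightarrow> 't \<Rightarrow> 't \<Rightarrow> 't" where
  "merge q a x = (if x = a then q else x)"

definition contract :: "'t \<Rightarrow> 't \<Rightarrow> ('t \<times> 't) set \<Rightarrow> ('t \<times> 't) set" where
  "contract q a E = {(merge q a x, merge q a y) | x y. (x, y) \<in> E \<and> merge q a x \<noteq> merge q a y}"

lemma rtrancl_contract:
  assumes "(x, y) \<in> (E \<inter> P \<times> P)\<^sup>*"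
  shows "(merge q a x, merge q a y) \<in> (contract q a E \<inter> (merge q a ` P) \<times> (merge q a ` P))\<^sup>*"
  using assms
proof (induction rule: rtrancl_induct)
  case (step y z)
  show ?case
  proof (cases "merge q a y = merge q a z")
    case False
    then have "(merge q a y, merge q a z) \<in> contract q a E \<inter> (merge q a ` P) \<times> (merge q a ` P)"
      using step unfolding contract_def by blast
    then show ?thesis using step by (meson rtrancl.rtrancl_into_rtrancl)
  qed (use step in simp)
qed simp

lemma conn_contract: "conn E P \<Longrightarrow> conn (contract q a E) (merge q a ` P)"
  unfolding conn_def using rtrancl_contract by fastforce

context host_tree
begin

lemma host_tree_contract:
  assumes qa: "(q, a) \<in> E"
  shows "host_tree (V - {a}) (contract q a E)"
proof
  have V: "q \<in> V" "a \<in> V" "q \<noteq> a" using qa EV irrE by auto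
  show "finite (V - {a})" "V - {a} \<noteq> {}" using finV V by auto
  show "contract q a E \<subseteq> (V - {a}) \<times> (V - {a})"
    using EV V unfolding contract_def merge_def by auto
  show "(v, u) \<in> contract q a E" if e: "(u, v) \<in> contract q a E" for u v
  proof -
    obtain x y where "(x, y) \<in> E" "u = merge q a x" "v = merge q a y" "u \<noteq> v"
      using e unfolding contract_def by blast
    then have "(y, x) \<in> E" "v = merge q a y" "u = merge q a x" "v \<noteq> u" using symE by auto
    then show ?thesis unfolding contract_def by blast
  qed
  show "(u, u) \<notin> contract q a E" for u unfolding contract_def by auto
  show "(u, v) \<in> (contract q a E)\<^sup>*" if uv: "u \<in> V - {a}" "v \<in> V - {a}" for u v
  proof -
    have "(u, v) \<in> (E \<inter> UNIV \<times> UNIV)\<^sup>*" using reach uv by simp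
    from rtrancl_contract[OF this, of q a]
    have "(merge q a u, merge q a v) \<in> (contract q a E)\<^sup>*" by (rule rtrancl_mono[THEN subsetD, rotated]) simp
    then show ?thesis using uv by (simp add: merge_def)
  qed
  show "\<exists>S. edge_cut (contract q a E) u' v' S" if "(u', v') \<in> contract q a E" for u' v'
  proof -
    obtain u v where uv: "(u, v) \<in> E" "u' = merge q a u" "v' = merge q a v" "u' \<noteq> v'"
      using \<open>(u', v') \<in> contract q a E\<close> unfolding contract_def by blast
    obtain S where S: "edge_cut E u v S" using cuts uv by blast
    then have cr: "\<And>x y. (x, y) \<in> E \<Longrightarrow> x \<in> S \<Longrightarrow> y \<notin> S \<Longrightarrow> x = u \<and> y = v"
      unfolding edge_cut_def by blast
    \<comment> \<open>The edge \<open>uv\<close> survives the contraction, so it is not the edge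
      \<open>qa\<close>, and its cut leaves \<open>q\<close> and \<open>a\<close> on the same side.
      Hence the same set is a cut after merging.\<close>
    have "q \<in> S \<longleftrightarrow> a \<in> S"
      using cr[OF qa] cr[OF symE[OF qa]] uv(2-4) unfolding merge_def by metis
    then have m: "merge q a x \<in> S \<longleftrightarrow> x \<in> S" for x unfolding merge_def by auto
    have "edge_cut (contract q a E) u' v' S"
      unfolding edge_cut_def
    proof (intro conjI allI impI; (elim conjE)?)
      show "u' \<in> S" "v' \<notin> S" using S m uv unfolding edge_cut_def by auto
      fix x y assume "(x, y) \<in> contract q a E" "x \<in> S" "y \<notin> S"
      then obtain s t where "(s, t) \<in> E" "x = merge q a s" "y = merge q a t" "s \<in> S" "t \<notin> S"
        unfolding contract_def using m by blast
      then show "x = u'" "y = v'" using cr uv by blast+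
    qed
    then show ?thesis by blast
  qed
qed

text \<open>The preimage of an end in \<open>P\<close> may be the wrong one of \<open>q\<close> and
  \<open>a\<close>. If \<open>s\<close> is replaced by its twin \<open>s'\<close> in
  \<open>P\<close> while its neighbour \<open>t\<close> is in \<open>P\<close>, then
  \<open>s\<close> lies between \<open>s'\<close> and \<open>t\<close>, and convexity puts it into
  \<open>P\<close>.\<close>

lemma contract_edge_lift:
  assumes qa: "(q, a) \<in> E" and P: "convex_in E P" "P \<subseteq> V"
    and e: "(x, y) \<in> contract q a E" "x \<in> merge q a ` P" "y \<in> merge q a ` P"
  obtains s t where "(s, t) \<in> E" "s \<in> P" "t \<in> P" "x = merge q a s" "y = merge q a t"
proof -
  have key: "s \<in> P" if s': "s' \<in> P" "t \<in> P" "(s, t) \<in> E" "merge q a s = merge q a s'"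
      "merge q a s \<noteq> merge q a t" for s s' t
  proof (cases "s = s'")
    case False
    then have ss: "(s, s') \<in> E" using s'(4) qa symE unfolding merge_def by (auto split: if_splits)
    obtain S where S: "edge_cut E s s' S" using cuts ss by blast
    then have "t \<in> S" "s' \<notin> S" using s' unfolding edge_cut_def by blast+
    then show ?thesis using convex_inD[OF P(1) ss S \<open>t \<in> P\<close> \<open>s' \<in> P\<close>] by blast
  qed (use s' in simp)
  obtain s t where st: "(s, t) \<in> E" "x = merge q a s" "y = merge q a t" "x \<noteq> y"
    using e(1) unfolding contract_def by blast
  obtain s' t' where st': "s' \<in> P" "t' \<in> P" "x = merge q a s'" "y = merge q a t'" using e by blast
  \<comment> \<open>Both ends cannot be replaced by a twin, since then both would be merged into
    \<open>q\<close> although \<open>x\<close> and \<open>y\<close> differ.\<close>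
  have "s \<in> P \<or> t \<in> P"
    using st st' unfolding merge_def by (metis (full_types))
  then have "s \<in> P \<and> t \<in> P"
    using key[of s' t s] key[of t' s t] st st' symE by metis
  then show thesis using that st by blast
qed

text \<open>The three edges lift to edges inside \<open>P\<close>. If their starting points are not
  all equal, these are \<open>q\<close> and \<open>a\<close>; two edges start at the same one, which
  has the other as a further neighbour in \<open>P\<close>, so the two far ends coincide.\<close>

lemma narrow_contract:
  assumes qa: "(q, a) \<in> E" and P: "convex_in E P" "P \<subseteq> V" "narrow E P"
  shows "narrow (contract q a E) (merge q a ` P)"
  unfolding narrow_def
proof (intro ballI impI; elim conjE)
  let ?m = "merge q a" and ?E = "contract q a E"
  fix x n1 n2 n3
  assume mem: "x \<in> ?m ` P" "n1 \<in> ?m ` P" "n2 \<in> ?m ` P" "n3 \<in> ?m ` P"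
    and e: "(x, n1) \<in> ?E" "(x, n2) \<in> ?E" "(x, n3) \<in> ?E"
  note lift = contract_edge_lift[OF qa P(1,2)]
  obtain s1 t1 where 1: "(s1, t1) \<in> E" "s1 \<in> P" "t1 \<in> P" "x = ?m s1" "n1 = ?m t1"
    using lift[OF e(1) mem(1,2)] by metis
  obtain s2 t2 where 2: "(s2, t2) \<in> E" "s2 \<in> P" "t2 \<in> P" "x = ?m s2" "n2 = ?m t2"
    using lift[OF e(2) mem(1,3)] by metis
  obtain s3 t3 where 3: "(s3, t3) \<in> E" "s3 \<in> P" "t3 \<in> P" "x = ?m s3" "n3 = ?m t3"
    using lift[OF e(3) mem(1,4)] by metis
  have nb: "x \<noteq> n1" "x \<noteq> n2" "x \<noteq> n3" using e unfolding contract_def by auto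
  have nar: "u = v \<or> v = w \<or> u = w"
    if "z \<in> P" "u \<in> P" "v \<in> P" "w \<in> P" "(z, u) \<in> E" "(z, v) \<in> E" "(z, w) \<in> E" for z u v w
    using P(3) that unfolding narrow_def by blast
  have two: "t = t'" if "(s, t) \<in> E" "(s, t') \<in> E" "s \<in> P" "t \<in> P" "t' \<in> P" "w \<in> P" "s \<noteq> w"
      "?m s = ?m w" "?m t \<noteq> ?m s" "?m t' \<noteq> ?m s" for s t t' w
  proof -
    have "(s, w) \<in> E" using that(7,8) qa symE unfolding merge_def by (auto split: if_splits)
    then show ?thesis using nar[of s t t' w] that by auto
  qed
  consider "s1 = s2" "s2 = s3" | "s1 = s2" "s1 \<noteq> s3" | "s1 = s3" "s1 \<noteq> s2" | "s2 = s3" "s1 \<noteq> s2"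
    using 1(4) 2(4) 3(4) unfolding merge_def by (metis (full_types))
  then show "n1 = n2 \<or> n2 = n3 \<or> n1 = n3"
  proof cases
    case 1
    then show ?thesis using nar[of s1 t1 t2 t3] \<open>(s1, t1) \<in> E\<close> \<open>s1 \<in> P\<close> \<open>t1 \<in> P\<close> 2 3 \<open>n1 = ?m t1\<close> by auto
  next
    case c: 2
    then show ?thesis using two[of s1 t1 t2 s3] 1 2 3 nb by auto
  next
    case c: 3
    then show ?thesis using two[of s1 t1 t3 s2] 1 2 3 nb by auto
  next
    case c: 4
    then show ?thesis using two[of s2 t2 t3 s1] 1 2 3 nb by auto
  qed
qed

end

text \<open>A new intersection could arise only between a path with \<open>q\<close> but not
  \<open>a\<close> and a path with \<open>a\<close> but not \<open>q\<close>; \<open>nest\<close>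
  excludes such pairs.\<close>

lemma model_contract:
  assumes m: "model U A V E P" and qa: "(q, a) \<in> E"
    and nest: "(\<forall>u\<in>U. a \<in> P u \<longrightarrow> q \<in> P u) \<or> (\<forall>u\<in>U. q \<in> P u \<longrightarrow> a \<in> P u)"
  shows "model U A (V - {a}) (contract q a E) (\<lambda>u. merge q a ` P u)"
proof -
  interpret host_tree V E using m unfolding model_def by blast
  have P: "P u \<subseteq> V" "P u \<noteq> {}" "conn E (P u)" "narrow E (P u)" if "u \<in> U" for u
    using m that unfolding model_def by blast+
  have "merge q a ` P u \<subseteq> V - {a}" if "u \<in> U" for u
    using P[OF that] qa EV irrE unfolding merge_def by auto
  moreover have "merge q a ` P u \<inter> merge q a ` P v = {} \<longleftrightarrow> P u \<inter> P v = {}"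
    if "u \<in> U" "v \<in> U" for u v
  proof
    assume "merge q a ` P u \<inter> merge q a ` P v = {}"
    then show "P u \<inter> P v = {}" by blast
  next
    assume d: "P u \<inter> P v = {}"
    have "x = y" if "x \<in> P u" "y \<in> P v" "merge q a x = merge q a y" for x y
      using that nest d \<open>u \<in> U\<close> \<open>v \<in> U\<close> unfolding merge_def by (auto split: if_splits)
    then show "merge q a ` P u \<inter> merge q a ` P v = {}" using d by blast
  qed
  moreover have "conn (contract q a E) (merge q a ` P u) \<and> narrow (contract q a E) (merge q a ` P u)"
    if "u \<in> U" for u
    using conn_contract[OF P(3)[OF that]]
      narrow_contract[OF qa conn_convex[OF P(3)[OF that]] P(1)[OF that] P(4)[OF that]] by simp
  ultimately show ?thesis
    using m host_tree_contract[OF qa] P unfolding model_def by simp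
qed

section \<open>Splitting a node of the host tree\<close>

definition split_edges :: "'t \<Rightarrow> 't \<Rightarrow> 't \<Rightarrow> 't \<Rightarrow> ('t \<times> 't) set \<Rightarrow> ('t \<times> 't) set" where
  "split_edges q a b r E = (E - {(q, a), (a, q), (q, b), (b, q)})
     \<union> {(q, r), (r, q), (r, a), (a, r), (r, b), (b, r)}"

text \<open>Paths that used the edge \<open>qa\<close> or \<open>qb\<close> make a detour through
  \<open>r\<close>. A path with all of \<open>q\<close>, \<open>a\<close> and \<open>b\<close> would
  become a claw centred at \<open>r\<close>, so splitting is applied only if there is none.\<close>

definition split_path :: "'t \<Rightarrow> 't \<Rightarrow> 't \<Rightarrow> 't \<Rightarrow> 't set \<Rightarrow> 't set" where
  "split_path q a b r P = (if q \<in> P \<and> (a \<in> P \<or> b \<in> P) then insert r P else P)"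

lemma split_edges_commute: "split_edges q a b r E = split_edges q b a r E"
  unfolding split_edges_def by blast

context host_tree
begin

text \<open>A cut inside \<open>V\<close> avoids the node \<open>r\<close> added by a splitting,
  whose side can then be chosen.\<close>

lemma cut_within:
  assumes "(u, v) \<in> E"
  obtains S where "edge_cut E u v S" "S \<subseteq> V"
proof -
  obtain S where "edge_cut E u v S" using cuts assms by blast
  then have "edge_cut E u v (S \<inter> V)" using assms EV unfolding edge_cut_def by blast
  then show thesis using that by blast
qed

text \<open>The cut of a surviving edge has \<open>q\<close>, \<open>a\<close> and \<open>b\<close>
  on one side; \<open>r\<close> is put on that side too.\<close>

lemma split_old_cut:
  assumes uv: "(u, v) \<in> E" "(u, v) \<in> split_edges q a b r E" and r: "r \<notin> V"
    and qa: "(q, a) \<in> E" "(q, b) \<in> E"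
  shows "\<exists>S. edge_cut (split_edges q a b r E) u v S"
proof -
  have qV: "q \<in> V" "a \<in> V" "b \<in> V" "u \<in> V" "v \<in> V" using qa uv(1) EV by auto
  have old: "(u, v) \<notin> {(q, a), (a, q), (q, b), (b, q)}"
    using uv(2) r qV unfolding split_edges_def by auto
  obtain S where S: "edge_cut E u v S" "S \<subseteq> V" using cut_within uv by blast
  then have cr: "\<And>x y. (x, y) \<in> E \<Longrightarrow> x \<in> S \<Longrightarrow> y \<notin> S \<Longrightarrow> x = u \<and> y = v"
    and mem: "u \<in> S" "v \<notin> S" unfolding edge_cut_def by blast+
  have same: "q \<in> S \<longleftrightarrow> a \<in> S" "q \<in> S \<longleftrightarrow> b \<in> S"
    using cr qa symE old by blast+
  let ?S = "if q \<in> S then insert r S else S"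
  have rS: "r \<notin> S" using r S by blast
  have "edge_cut (split_edges q a b r E) u v ?S"
    unfolding edge_cut_def
  proof (intro conjI allI impI; (elim conjE)?)
    show "u \<in> ?S" using mem by simp
    show "v \<notin> ?S" using mem qV r by auto
    fix x y assume e: "(x, y) \<in> split_edges q a b r E" and xy: "x \<in> ?S" "y \<notin> ?S"
    have "x \<noteq> r \<and> y \<noteq> r"
    proof (rule ccontr)
      assume "\<not> (x \<noteq> r \<and> y \<noteq> r)"
      moreover have "x = r \<Longrightarrow> y \<in> {q, a, b}" "y = r \<Longrightarrow> x \<in> {q, a, b}"
        using e r EV unfolding split_edges_def by auto
      ultimately show False using xy same rS by (auto split: if_splits)
    qed
    then have "(x, y) \<in> E" "x \<in> S" "y \<notin> S" using e xy unfolding split_edges_def by (auto split: if_splits)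
    then show "x = u" "y = v" using cr by blast+
  qed
  then show ?thesis by blast
qed

text \<open>The side of \<open>a\<close> is unaffected by the splitting, except that its only exit
  now leads to \<open>r\<close> instead of \<open>q\<close>.\<close>

lemma split_side_cut:
  assumes qa: "(q, a) \<in> E" "(q, b) \<in> E" "a \<noteq> b" and r: "r \<notin> V"
    and S: "edge_cut E a q S" "S \<subseteq> V"
  shows "edge_cut (split_edges q a b r E) a r S" "b \<notin> S"
proof -
  have cr: "\<And>x y. (x, y) \<in> E \<Longrightarrow> x \<in> S \<Longrightarrow> y \<notin> S \<Longrightarrow> x = a \<and> y = q"
    and mem: "a \<in> S" "q \<notin> S" using S unfolding edge_cut_def by blast+
  show b: "b \<notin> S" using cr[OF symE[OF qa(2)]] mem qa(3) by blast
  have rS: "r \<notin> S" using r S by blast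
  show "edge_cut (split_edges q a b r E) a r S"
    unfolding edge_cut_def
  proof (intro conjI allI impI; (elim conjE)?)
    show "a \<in> S" "r \<notin> S" by fact+
    fix x y assume e: "(x, y) \<in> split_edges q a b r E" and xy: "x \<in> S" "y \<notin> S"
    have "x \<noteq> r" "x \<noteq> q" "x \<noteq> b" using xy rS mem b by auto
    then show "x = a" "y = r" using e xy cr[of x y] unfolding split_edges_def by auto
  qed
qed

text \<open>The cut consists of \<open>r\<close> and the old sides of \<open>a\<close> and
  \<open>b\<close>, which now hang together on the edge \<open>rq\<close>.\<close>

lemma split_stem_cut:
  assumes qa: "(q, a) \<in> E" "(q, b) \<in> E" "a \<noteq> b" and r: "r \<notin> V"
  shows "\<exists>S. edge_cut (split_edges q a b r E) r q S"
proof -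
  obtain S where S: "edge_cut E a q S" "S \<subseteq> V" using cut_within symE qa by metis
  obtain T where T: "edge_cut E b q T" "T \<subseteq> V" using cut_within symE qa by metis
  have crS: "\<And>x y. (x, y) \<in> E \<Longrightarrow> x \<in> S \<Longrightarrow> y \<notin> S \<Longrightarrow> x = a \<and> y = q"
    and memS: "a \<in> S" "q \<notin> S" using S unfolding edge_cut_def by blast+
  have crT: "\<And>x y. (x, y) \<in> E \<Longrightarrow> x \<in> T \<Longrightarrow> y \<notin> T \<Longrightarrow> x = b \<and> y = q"
    and memT: "b \<in> T" "q \<notin> T" using T unfolding edge_cut_def by blast+
  have rST: "r \<notin> S" "r \<notin> T" using r S T by auto
  have rq: "r \<noteq> q" using r qa EV by blast
  have "edge_cut (split_edges q a b r E) r q (insert r (S \<union> T))"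
    unfolding edge_cut_def
  proof (intro conjI allI impI; (elim conjE)?)
    show "r \<in> insert r (S \<union> T)" "q \<notin> insert r (S \<union> T)" using memS memT rq by auto
    fix x y assume e: "(x, y) \<in> split_edges q a b r E" and xy: "x \<in> insert r (S \<union> T)" "y \<notin> insert r (S \<union> T)"
    have y: "y \<noteq> r" "y \<notin> S" "y \<notin> T" "y \<noteq> a" "y \<noteq> b" using xy memS memT by auto
    have "x = r"
    proof (rule ccontr)
      assume x: "x \<noteq> r"
      then have E: "(x, y) \<in> E" "(x, y) \<notin> {(q, a), (a, q), (q, b), (b, q)}"
        using e y unfolding split_edges_def by auto
      have "x \<in> S \<or> x \<in> T" using xy x by auto
      then show False using crS[OF E(1)] crT[OF E(1)] E(2) y by auto
    qed
    moreover have "(r, y) \<notin> E" using r EV by blast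
    ultimately show "x = r" "y = q" using e y unfolding split_edges_def by auto
  qed
  then show ?thesis by blast
qed

lemma host_tree_split:
  assumes qa: "(q, a) \<in> E" "(q, b) \<in> E" "a \<noteq> b" and r: "r \<notin> V"
  shows "host_tree (insert r V) (split_edges q a b r E)"
proof
  let ?E = "split_edges q a b r E"
  have V: "q \<in> V" "a \<in> V" "b \<in> V" using qa EV by auto
  have sy: "(v, u) \<in> ?E" if "(u, v) \<in> ?E" for u v
  proof (cases "(u, v) \<in> {(q, r), (r, q), (r, a), (a, r), (r, b), (b, r)}")
    case True
    then show ?thesis unfolding split_edges_def by blast
  next
    case False
    then have "(v, u) \<in> E" "(v, u) \<notin> {(q, a), (a, q), (q, b), (b, q)}"
      using that symE[of u v] unfolding split_edges_def by blast+
    then show ?thesis unfolding split_edges_def by blast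
  qed
  show "(v, u) \<in> ?E" if "(u, v) \<in> ?E" for u v using sy that .
  show "finite (insert r V)" "insert r V \<noteq> {}" using finV by auto
  show "?E \<subseteq> insert r V \<times> insert r V" using EV V unfolding split_edges_def by auto
  show "(u, u) \<notin> ?E" for u using irrE V r unfolding split_edges_def by auto
  have new: "(q, r) \<in> ?E" "(r, q) \<in> ?E" "(r, a) \<in> ?E" "(a, r) \<in> ?E" "(r, b) \<in> ?E" "(b, r) \<in> ?E"
    unfolding split_edges_def by auto
  have "E \<subseteq> ?E\<^sup>*"
  proof (intro subrelI)
    fix x y assume "(x, y) \<in> E"
    then consider "(x, y) \<in> ?E" | "(x, y) = (q, a)" | "(x, y) = (a, q)" | "(x, y) = (q, b)" | "(x, y) = (b, q)"
      unfolding split_edges_def by blast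
    then show "(x, y) \<in> ?E\<^sup>*" using new by cases (auto intro: rtrancl_trans[OF r_into_rtrancl r_into_rtrancl])
  qed
  then have Es: "E\<^sup>* \<subseteq> ?E\<^sup>*" by (rule rtrancl_subset_rtrancl)
  have "(u, q) \<in> ?E\<^sup>*" "(q, u) \<in> ?E\<^sup>*" if "u \<in> insert r V" for u
    using that new Es reach V by (cases "u = r"; auto)+
  then show "(u, v) \<in> ?E\<^sup>*" if "u \<in> insert r V" "v \<in> insert r V" for u v
    using that by (meson rtrancl_trans)
  have flip: "\<exists>S. edge_cut ?E v u S" if "\<exists>S. edge_cut ?E u v S" for u v
    using that sy unfolding edge_cut_def by (metis ComplI Compl_iff)
  have side: "\<exists>S. edge_cut ?E a r S"
    using split_side_cut[OF qa r] cut_within symE[OF qa(1)] by metis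
  have "b \<noteq> a" using qa by simp
  then have side': "\<exists>S. edge_cut ?E b r S"
    using split_side_cut[OF qa(2,1) _ r] cut_within symE[OF qa(2)] split_edges_commute[of q a b r E] by metis
  have stem: "\<exists>S. edge_cut ?E r q S" using split_stem_cut[OF qa r] .
  show "\<exists>S. edge_cut ?E u v S" if "(u, v) \<in> ?E" for u v
  proof (cases "(u, v) \<in> E")
    case True
    then show ?thesis using split_old_cut[OF True that r qa(1,2)] by blast
  next
    case False
    then have "(u, v) \<in> {(q, r), (r, q), (r, a), (a, r), (r, b), (b, r)}"
      using that unfolding split_edges_def by auto
    then show ?thesis using side side' stem flip by auto
  qed
qed

lemma conn_split:
  assumes P: "conn E P" "P \<subseteq> V" "\<not> (q \<in> P \<and> a \<in> P \<and> b \<in> P)"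
  shows "conn (split_edges q a b r E) (split_path q a b r P)"
proof -
  let ?P = "split_path q a b r P"
  let ?R = "split_edges q a b r E \<inter> ?P \<times> ?P"
  have sub: "P \<subseteq> ?P" unfolding split_path_def by auto
  have "(x, y) \<in> ?R\<^sup>*" if xy: "(x, y) \<in> E \<inter> P \<times> P" for x y
  proof (cases "(x, y) \<in> {(q, a), (a, q), (q, b), (b, q)}")
    case True
    then have "q \<in> P" "a \<in> P \<or> b \<in> P" using xy by auto
    \<comment> \<open>A removed edge inside \<open>P\<close> is replaced by two steps through
      \<open>r\<close>.\<close>
    then have "r \<in> ?P" unfolding split_path_def by auto
    then have "(x, r) \<in> ?R" "(r, y) \<in> ?R" using True xy sub unfolding split_edges_def by auto
    then show ?thesis by (meson r_into_rtrancl rtrancl.rtrancl_into_rtrancl)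
  next
    case False
    then have "(x, y) \<in> ?R" using xy sub unfolding split_edges_def by blast
    then show ?thesis by blast
  qed
  then have "E \<inter> P \<times> P \<subseteq> ?R\<^sup>*" by (intro subrelI) blast
  then have "(E \<inter> P \<times> P)\<^sup>* \<subseteq> ?R\<^sup>*" by (rule rtrancl_subset_rtrancl)
  then have old: "(x, y) \<in> ?R\<^sup>*" if "x \<in> P" "y \<in> P" for x y
    using P(1) that unfolding conn_def by blast
  show ?thesis
  proof (cases "?P = P")
    case True
    then show ?thesis using old unfolding conn_def by simp
  next
    case False
    then have P': "?P = insert r P" "q \<in> P" unfolding split_path_def by (auto split: if_splits)
    then have "(q, r) \<in> ?R" "(r, q) \<in> ?R" unfolding split_edges_def by auto
    then have "(x, q) \<in> ?R\<^sup>*" "(q, x) \<in> ?R\<^sup>*" if "x \<in> ?P" for x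
      using that old P' by (cases "x = r"; auto)+
    then show ?thesis unfolding conn_def by (meson rtrancl_trans)
  qed
qed

lemma narrow_mono:
  assumes "narrow E P" "\<And>x y. x \<in> P \<Longrightarrow> y \<in> P \<Longrightarrow> (x, y) \<in> F \<Longrightarrow> (x, y) \<in> E"
  shows "narrow F P"
  unfolding narrow_def
proof (intro ballI impI; elim conjE)
  fix x a b c assume "x \<in> P" "a \<in> P" "b \<in> P" "c \<in> P" "(x, a) \<in> F" "(x, b) \<in> F" "(x, c) \<in> F"
  then have "(x, a) \<in> E" "(x, b) \<in> E" "(x, c) \<in> E" by (simp_all add: assms(2))
  then show "a = b \<or> b = c \<or> a = c"
    using assms(1) \<open>x \<in> P\<close> \<open>a \<in> P\<close> \<open>b \<in> P\<close> \<open>c \<in> P\<close> unfolding narrow_def by blast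
qed

text \<open>On the new path \<open>r\<close> has only the neighbours \<open>q\<close> and
  \<open>a\<close>. At \<open>q\<close> it takes the place of \<open>a\<close>, and at
  \<open>a\<close> that of \<open>q\<close>, so renaming \<open>r\<close> turns three neighbours
  into three old ones.\<close>

lemma narrow_split_aux:
  assumes P: "narrow E P" "P \<subseteq> V" "q \<in> P" "a \<in> P" "b \<notin> P" and r: "r \<notin> V"
    and qa: "(q, a) \<in> E" and qb: "(q, b) \<in> E"
  shows "narrow (split_edges q a b r E) (insert r P)"
proof -
  let ?E = "split_edges q a b r E"
  have nr: "(x, r) \<notin> E" "(r, x) \<notin> E" for x using r EV by auto
  have rP: "r \<notin> P" and ne: "q \<noteq> a" "q \<noteq> b" "a \<noteq> b" "r \<noteq> b" "r \<noteq> a" "r \<noteq> q"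
    using r P irrE qa qb EV by auto
  show ?thesis unfolding narrow_def
  proof (intro ballI impI; elim conjE)
    fix x n1 n2 n3
    assume x: "x \<in> insert r P" and m: "n1 \<in> insert r P" "n2 \<in> insert r P" "n3 \<in> insert r P"
      and e: "(x, n1) \<in> ?E" "(x, n2) \<in> ?E" "(x, n3) \<in> ?E"
    have nar: "u = v \<or> v = w \<or> u = w"
      if "x \<in> P" "u \<in> P" "v \<in> P" "w \<in> P" "(x, u) \<in> E" "(x, v) \<in> E" "(x, w) \<in> E" for u v w
      using P(1) that unfolding narrow_def by blast
    consider "x = r" | "x = q" | "x = a" | "x \<in> P" "x \<noteq> q" "x \<noteq> a" "x \<noteq> r" using x by auto
    then show "n1 = n2 \<or> n2 = n3 \<or> n1 = n3"
    proof cases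
      case 1
      have "n = q \<or> n = a" if "(r, n) \<in> ?E" "n \<in> insert r P" for n
        using that nr P rP ne unfolding split_edges_def by auto
      then show ?thesis using e m 1 by metis
    next
      case 2
      let ?f = "\<lambda>n. if n = r then a else n"
      have f: "?f n \<in> P \<and> (q, ?f n) \<in> E \<and> n \<noteq> a" if "(q, n) \<in> ?E" "n \<in> insert r P" for n
        using that qa P rP ne r unfolding split_edges_def by auto
      have "?f n1 = ?f n2 \<or> ?f n2 = ?f n3 \<or> ?f n1 = ?f n3"
        using nar[of "?f n1" "?f n2" "?f n3"] f[of n1] f[of n2] f[of n3] e m P(3,4) unfolding 2 by blast
      then show ?thesis using f[of n1] f[of n2] f[of n3] e m 2 by metis
    next
      case 3
      let ?f = "\<lambda>n. if n = r then q else n"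
      have f: "?f n \<in> P \<and> (a, ?f n) \<in> E \<and> n \<noteq> q" if "(a, n) \<in> ?E" "n \<in> insert r P" for n
        using that symE[OF qa] P rP ne r unfolding split_edges_def by auto
      have "?f n1 = ?f n2 \<or> ?f n2 = ?f n3 \<or> ?f n1 = ?f n3"
        using nar[of "?f n1" "?f n2" "?f n3"] f[of n1] f[of n2] f[of n3] e m P(3,4) unfolding 3 by blast
      then show ?thesis using f[of n1] f[of n2] f[of n3] e m 3 by metis
    next
      case 4
      then have f: "n \<in> P \<and> (x, n) \<in> E" if "(x, n) \<in> ?E" "n \<in> insert r P" for n
        using that P rP nr ne unfolding split_edges_def by auto
      show ?thesis using nar 4 f e m by metis
    qed
  qed
qed

lemma narrow_split:
  assumes P: "narrow E P" "P \<subseteq> V" "\<not> (q \<in> P \<and> a \<in> P \<and> b \<in> P)"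
    and r: "r \<notin> V" and qa: "(q, a) \<in> E" "(q, b) \<in> E"
  shows "narrow (split_edges q a b r E) (split_path q a b r P)"
proof -
  consider "q \<in> P" "a \<in> P" "b \<notin> P" | "q \<in> P" "b \<in> P" "a \<notin> P" | "split_path q a b r P = P"
    using P(3) unfolding split_path_def by (cases "q \<in> P"; cases "a \<in> P"; cases "b \<in> P") auto
  then show ?thesis
  proof cases
    case 1
    then show ?thesis using narrow_split_aux[OF P(1,2) 1 r qa] by (simp add: split_path_def)
  next
    case 2
    then show ?thesis using narrow_split_aux[OF P(1,2) 2 r qa(2,1)] split_edges_commute[of q a b r E]
      by (simp add: split_path_def)
  next
    case 3
    have "split_edges q a b r E \<inter> P \<times> P \<subseteq> E" using P r unfolding split_edges_def by auto
    then have "narrow (split_edges q a b r E) P" by (intro narrow_mono[OF P(1)]) blast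
    then show ?thesis using 3 by simp
  qed
qed

end

text \<open>This is \<open>h\<close>-colourability of the conflict graph at \<open>q\<close>, in
  which two neighbours of \<open>q\<close> are joined if some path through \<open>q\<close> contains
  both.\<close>

definition branch_colorable :: "'a set \<Rightarrow> nat \<Rightarrow> ('t \<times> 't) set \<Rightarrow> ('a \<Rightarrow> 't set) \<Rightarrow> 't \<Rightarrow> bool" where
  "branch_colorable U h E P q \<longleftrightarrow> (\<exists>c :: 't \<Rightarrow> nat. (\<forall>a. (q, a) \<in> E \<longrightarrow> c a < h) \<and>
     (\<forall>v\<in>U. \<forall>a\<in>P v. \<forall>b\<in>P v. q \<in> P v \<and> a \<noteq> b \<and> (q, a) \<in> E \<and> (q, b) \<in> E \<longrightarrow> c a \<noteq> c b))"

lemma model_split: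
  assumes m: "model U A V E P" and qa: "(q, a) \<in> E" "(q, b) \<in> E" "a \<noteq> b" and r: "r \<notin> V"
    and no: "\<And>v. v \<in> U \<Longrightarrow> \<not> (q \<in> P v \<and> a \<in> P v \<and> b \<in> P v)"
  shows "model U A (insert r V) (split_edges q a b r E) (\<lambda>v. split_path q a b r (P v))"
proof -
  interpret host_tree V E using m unfolding model_def by blast
  have P: "P u \<subseteq> V" "P u \<noteq> {}" "conn E (P u)" "narrow E (P u)" if "u \<in> U" for u
    using m that unfolding model_def by blast+
  have "split_path q a b r (P u) \<subseteq> insert r V \<and> split_path q a b r (P u) \<noteq> {}" if "u \<in> U" for u
    using P[OF that] unfolding split_path_def by auto
  moreover have "split_path q a b r (P u) \<inter> split_path q a b r (P v) = {} \<longleftrightarrow> P u \<inter> P v = {}"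
    if "u \<in> U" "v \<in> U" for u v
    using P(1)[OF that(1)] P(1)[OF that(2)] r unfolding split_path_def by auto
  moreover have "conn (split_edges q a b r E) (split_path q a b r (P u)) \<and> narrow (split_edges q a b r E) (split_path q a b r (P u))"
    if "u \<in> U" for u
    using conn_split[OF P(3)[OF that] P(1)[OF that] no[OF that]]
      narrow_split[OF P(4)[OF that] P(1)[OF that] no[OF that] r qa(1,2)] by simp
  ultimately show ?thesis
    using m host_tree_split[OF qa r] unfolding model_def by simp
qed

section \<open>Degree reduction by repeated splitting\<close>

context host_tree
begin

lemma split_nbrs:
  assumes qa: "(q, a) \<in> E" "(q, b) \<in> E" "a \<noteq> b" and r: "r \<notin> V"
  shows "split_edges q a b r E `` {q} = insert r (E `` {q} - {a, b})"
    and "split_edges q a b r E `` {a} = insert r (E `` {a} - {q})"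
    and "split_edges q a b r E `` {b} = insert r (E `` {b} - {q})"
    and "split_edges q a b r E `` {r} = {q, a, b}"
    and "x \<noteq> q \<Longrightarrow> x \<noteq> a \<Longrightarrow> x \<noteq> b \<Longrightarrow> x \<noteq> r \<Longrightarrow> split_edges q a b r E `` {x} = E `` {x}"
proof -
  have ne: "q \<noteq> a" "q \<noteq> b" "r \<noteq> q" "r \<noteq> a" "r \<noteq> b" using qa irrE r EV by auto
  have nr: "(x, r) \<notin> E" "(r, x) \<notin> E" for x using r EV by auto
  show "split_edges q a b r E `` {q} = insert r (E `` {q} - {a, b})"
    "split_edges q a b r E `` {a} = insert r (E `` {a} - {q})"
    "split_edges q a b r E `` {b} = insert r (E `` {b} - {q})"
    "split_edges q a b r E `` {r} = {q, a, b}"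
    "x \<noteq> q \<Longrightarrow> x \<noteq> a \<Longrightarrow> x \<noteq> b \<Longrightarrow> x \<noteq> r \<Longrightarrow> split_edges q a b r E `` {x} = E `` {x}"
    using ne nr qa(3) unfolding split_edges_def by auto
qed

lemma finite_nbrs: "finite (E `` {x})"
proof (rule finite_subset)
  show "E `` {x} \<subseteq> V" using EV by blast
qed (rule finV)

text \<open>At \<open>q\<close> the node \<open>r\<close> gets the common colour of \<open>a\<close>
  and \<open>b\<close>; at \<open>a\<close> and at \<open>b\<close> it inherits the colour of
  \<open>q\<close>; at \<open>r\<close> a new colouring is chosen; all other nodes keep
  theirs.\<close>

lemma branch_colorable_split:
  assumes qa: "(q, a) \<in> E" "(q, b) \<in> E" "a \<noteq> b" and r: "r \<notin> V"
    and P: "\<And>v. v \<in> U \<Longrightarrow> P v \<subseteq> V" and h: "h \<ge> 3"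
    and c: "\<And>a. (q, a) \<in> E \<Longrightarrow> c a < h"
      "\<And>v a b. v \<in> U \<Longrightarrow> a \<in> P v \<Longrightarrow> b \<in> P v \<Longrightarrow> q \<in> P v \<Longrightarrow> a \<noteq> b \<Longrightarrow> (q, a) \<in> E \<Longrightarrow> (q, b) \<in> E
         \<Longrightarrow> c a \<noteq> c b"
    and cab: "(c a :: nat) = c b"
    and bc: "\<And>x. x \<in> V \<Longrightarrow> branch_colorable U h E P x"
    and x: "x \<in> insert r V"
  shows "branch_colorable U h (split_edges q a b r E) (\<lambda>v. split_path q a b r (P v)) x"
proof -
  let ?E = "split_edges q a b r E" and ?P = "\<lambda>v. split_path q a b r (P v)"
  have ne: "q \<noteq> a" "q \<noteq> b" "r \<noteq> q" "r \<noteq> a" "r \<noteq> b" using qa irrE r EV by auto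
  have V: "q \<in> V" "a \<in> V" "b \<in> V" using qa EV by auto
  note nb = split_nbrs[OF qa r]
  have old: "n \<in> P v" if "n \<in> ?P v" "n \<noteq> r" for n v
    using that unfolding split_path_def by (auto split: if_splits)
  have new: "q \<in> P v \<and> (a \<in> P v \<or> b \<in> P v)" if "r \<in> ?P v" "v \<in> U" for v
    using that r P[OF that(2)] unfolding split_path_def by (auto split: if_splits)
  have leaf: "branch_colorable U h ?E ?P y"
    if y: "?E `` {y} = insert r (E `` {y} - {q})" "y \<in> V" "y \<noteq> r" "(y, q) \<in> E" for y
  proof -
    obtain d where d: "\<And>a. (y, a) \<in> E \<Longrightarrow> d a < h"
      "\<And>v a b. v \<in> U \<Longrightarrow> a \<in> P v \<Longrightarrow> b \<in> P v \<Longrightarrow> y \<in> P v \<Longrightarrow> a \<noteq> b \<Longrightarrow> (y, a) \<in> E \<Longrightarrow> (y, b) \<in> E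
         \<Longrightarrow> (d a :: nat) \<noteq> d b"
      using bc[OF y(2)] unfolding branch_colorable_def by blast
    let ?d = "d(r := d q)"
    have nbr: "(y, n) \<in> ?E \<longleftrightarrow> n = r \<or> ((y, n) \<in> E \<and> n \<noteq> q)" for n using y(1) by blast
    have "?d n < h" if "(y, n) \<in> ?E" for n using that nbr d(1) y(4) by auto
    moreover have "?d n \<noteq> ?d n'"
      if w: "v \<in> U" "n \<in> ?P v" "n' \<in> ?P v" "y \<in> ?P v" "n \<noteq> n'" "(y, n) \<in> ?E" "(y, n') \<in> ?E" for v n n'
    proof -
      let ?f = "\<lambda>m. if m = r then q else m"
      have yP: "y \<in> P v" using old w y by simp
      have f: "?f m \<in> P v \<and> (y, ?f m) \<in> E" if "m \<in> ?P v" "(y, m) \<in> ?E" for m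
        using that old new[of v] w(1) nbr y(4) by auto
      have ne: "?f n \<noteq> ?f n'" using w nbr by auto
      have "d (?f n) \<noteq> d (?f n')"
        using d(2)[OF w(1) _ _ yP ne] f[of n] f[of n'] w by blast
      then show ?thesis by (auto split: if_splits)
    qed
    ultimately show ?thesis unfolding branch_colorable_def by blast
  qed
  consider "x = q" | "x = r" | "x = a" | "x = b" | "x \<noteq> q" "x \<noteq> a" "x \<noteq> b" "x \<noteq> r" by blast
  then show ?thesis
  proof cases
    case 1
    let ?c = "c(r := c a)"
    have nbr: "(q, n) \<in> ?E \<longleftrightarrow> n = r \<or> ((q, n) \<in> E \<and> n \<noteq> a \<and> n \<noteq> b)" for n using nb(1) by blast
    have lt: "?c n < h" if "(q, n) \<in> ?E" for n using that nbr c(1) qa by auto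
    have stem: "c a \<noteq> c n" if "v \<in> U" "r \<in> ?P v" "n \<in> ?P v" "n \<noteq> r" "(q, n) \<in> ?E" for v n
    proof -
      have n: "n \<in> P v" "(q, n) \<in> E" "n \<noteq> a" "n \<noteq> b" using that old nbr by auto
      have "q \<in> P v" "a \<in> P v \<or> b \<in> P v" using new that by blast+
      then show ?thesis using c(2)[OF \<open>v \<in> U\<close> _ n(1), of a] c(2)[OF \<open>v \<in> U\<close> _ n(1), of b] n qa cab by auto
    qed
    have "?c n \<noteq> ?c n'"
      if w: "v \<in> U" "n \<in> ?P v" "n' \<in> ?P v" "q \<in> ?P v" "n \<noteq> n'" "(q, n) \<in> ?E" "(q, n') \<in> ?E" for v n n'
    proof -
      have qP: "q \<in> P v" using old w ne by simp
      consider "n = r" "n' \<noteq> r" | "n' = r" "n \<noteq> r" | "n \<noteq> r" "n' \<noteq> r" using w by blast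
      then show ?thesis
      proof cases
        case 1
        then show ?thesis using stem[of v n'] w by simp
      next
        case 2
        then show ?thesis using stem[of v n] w by simp
      next
        case 3
        then show ?thesis using c(2)[of v n n'] old w nbr qP by auto
      qed
    qed
    then show ?thesis using lt 1 unfolding branch_colorable_def by blast
  next
    case 2
    \<comment> \<open>The neighbours \<open>q\<close>, \<open>a\<close> and \<open>b\<close> of
      \<open>r\<close> receive 0, 1 and 2, which are below \<open>h\<close> because \<open>h\<close>
      is at least 3.\<close>
    let ?c = "(\<lambda>_. 0 :: nat)(a := 1, b := 2)"
    have nbr: "(r, n) \<in> ?E \<longleftrightarrow> n = q \<or> n = a \<or> n = b" for n using nb(4) by blast
    have "?c n < h" for n using h by simp
    moreover have "?c n \<noteq> ?c n'" if "n \<noteq> n'" "(r, n) \<in> ?E" "(r, n') \<in> ?E" for n n'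
      using that nbr ne qa(3) by auto
    ultimately show ?thesis using 2 unfolding branch_colorable_def by blast
  next
    case 3
    then show ?thesis using leaf[OF nb(2) V(2)] ne symE qa by simp
  next
    case 4
    then show ?thesis using leaf[OF nb(3) V(3)] ne symE qa by simp
  next
    case 5
    then have xV: "x \<in> V" using x by blast
    obtain d where d: "\<And>a. (x, a) \<in> E \<Longrightarrow> d a < h"
      "\<And>v a b. v \<in> U \<Longrightarrow> a \<in> P v \<Longrightarrow> b \<in> P v \<Longrightarrow> x \<in> P v \<Longrightarrow> a \<noteq> b \<Longrightarrow> (x, a) \<in> E \<Longrightarrow> (x, b) \<in> E
         \<Longrightarrow> (d a :: nat) \<noteq> d b"
      using bc[OF xV] unfolding branch_colorable_def by blast
    have nbr: "(x, n) \<in> ?E \<longleftrightarrow> (x, n) \<in> E" for n using nb(5)[OF 5] by blast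
    have nr: "(x, r) \<notin> E" using r EV by blast
    have "d n \<noteq> d n'"
      if "v \<in> U" "n \<in> ?P v" "n' \<in> ?P v" "x \<in> ?P v" "n \<noteq> n'" "(x, n) \<in> ?E" "(x, n') \<in> ?E" for v n n'
    proof -
      have "n \<noteq> r" "n' \<noteq> r" using that nbr nr by auto
      then show ?thesis using d(2)[of v n n'] old 5(4) that nbr by simp
    qed
    then show ?thesis using d(1) nbr unfolding branch_colorable_def by blast
  qed
qed

end

text \<open>Induction on the total excess of the degrees over \<open>h\<close>, where truncated
  subtraction makes nodes of small degree count 0. A node with more than \<open>h\<close> neighbours
  has two of the same colour; splitting them off lowers its degree by one, keeps the degrees of the
  other old nodes, and adds a node of degree 3, which has no excess.\<close>

lemma model_bounded_degree:
  assumes "model U A V E (P :: 'a \<Rightarrow> nat set)" and h: "h \<ge> 3"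
    and "\<And>q. q \<in> V \<Longrightarrow> branch_colorable U h E P q"
  shows "\<exists>V E (P :: 'a \<Rightarrow> nat set). model U A V E P \<and> (\<forall>q\<in>V. card (E `` {q}) \<le> h)"
  using assms(1,3)
proof (induction "\<Sum>q\<in>V. card (E `` {q}) - h" arbitrary: V E P rule: less_induct)
  case less
  interpret host_tree V E using less.prems unfolding model_def by blast
  show ?case
  proof (cases "\<forall>q\<in>V. card (E `` {q}) \<le> h")
    case True
    then show ?thesis using less.prems by blast
  next
    case False
    then obtain q where q: "q \<in> V" "card (E `` {q}) > h" by force
    have P: "P u \<subseteq> V" if "u \<in> U" for u using less.prems(1) that unfolding model_def by blast
    obtain c where c: "\<And>a. (q, a) \<in> E \<Longrightarrow> c a < h"
      "\<And>v a b. v \<in> U \<Longrightarrow> a \<in> P v \<Longrightarrow> b \<in> P v \<Longrightarrow> q \<in> P v \<Longrightarrow> a \<noteq> b \<Longrightarrow> (q, a) \<in> E \<Longrightarrow> (q, b) \<in> E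
         \<Longrightarrow> (c a :: nat) \<noteq> c b"
      using less.prems(2)[OF q(1)] unfolding branch_colorable_def by blast
    have "\<not> inj_on c (E `` {q})"
    proof
      assume "inj_on c (E `` {q})"
      then have "card (E `` {q}) \<le> card {..<h}" using c(1) by (intro card_inj_on_le) auto
      then show False using q by simp
    qed
    then obtain a b where ab: "(q, a) \<in> E" "(q, b) \<in> E" "a \<noteq> b" "c a = c b"
      unfolding inj_on_def by blast
    obtain r where r: "r \<notin> V" using finV ex_new_if_finite infinite_UNIV_nat by blast
    let ?E = "split_edges q a b r E" and ?P = "\<lambda>v. split_path q a b r (P v)"
    have no: "\<not> (q \<in> P v \<and> a \<in> P v \<and> b \<in> P v)" if "v \<in> U" for v
      using c(2)[OF that, of a b] ab by blast
    have m: "model U A (insert r V) ?E ?P"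
      by (rule model_split[OF less.prems(1) ab(1,2,3) r no])
    have bc: "branch_colorable U h ?E ?P x" if "x \<in> insert r V" for x
      by (rule branch_colorable_split[OF ab(1,2,3) r P h c ab(4) less.prems(2) that])
    note nb = split_nbrs[OF ab(1,2,3) r]
    have Va: "a \<in> V" "b \<in> V" using ab EV by auto
    have nr: "(x, r) \<notin> E" for x using r EV by auto
    have cq: "card (?E `` {q}) < card (E `` {q})"
    proof -
      have "card (E `` {q} - {a, b}) = card (E `` {q}) - 2"
        using ab finite_nbrs by (subst card_Diff_subset) auto
      then have "card (insert r (E `` {q} - {a, b})) = Suc (card (E `` {q}) - 2)"
        using finite_nbrs[of q] nr by simp
      then show ?thesis using nb(1) q(2) h by simp
    qed
    have leaf: "card (?E `` {y}) = card (E `` {y})" if "?E `` {y} = insert r (E `` {y} - {q})" "(y, q) \<in> E" for y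
    proof -
      have "card (E `` {y}) = Suc (card (E `` {y} - {q}))"
        using that(2) finite_nbrs[of y] by (metis Image_singleton_iff card_Suc_Diff1)
      then show ?thesis using that finite_nbrs[of y] nr by simp
    qed
    have le: "card (?E `` {x}) - h \<le> card (E `` {x}) - h" if "x \<in> V" for x
    proof -
      have "x \<noteq> r" using that r by blast
      then consider "x = q" | "x = a" | "x = b" | "?E `` {x} = E `` {x}" using nb(5)[of x] by blast
      then show ?thesis
      proof cases
        case 1
        then show ?thesis using cq by simp
      next
        case 2
        then show ?thesis using leaf[OF nb(2)] symE ab by simp
      next
        case 3
        then show ?thesis using leaf[OF nb(3)] symE ab by simp
      qed simp
    qed
    have "card {q, a, b} \<le> 3" by (simp add: card_insert_if)
    then have r0: "card (?E `` {r}) - h = 0" using nb(4) h by simp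
    have "(\<Sum>x\<in>V. card (?E `` {x}) - h) < (\<Sum>x\<in>V. card (E `` {x}) - h)"
      using le cq q finV by (intro sum_strict_mono_ex1) (auto intro!: bexI[of _ q])
    then have "(\<Sum>x\<in>insert r V. card (?E `` {x}) - h) < (\<Sum>x\<in>V. card (E `` {x}) - h)"
      using r0 r finV by simp
    then show ?thesis using less.hyps m bc by blast
  qed
qed

section \<open>Host trees as digraphs\<close>

lemma (in wf_digraph) awalk_consecutive:
  assumes "awalk u p v" "Suc i < length (awalk_verts u p)"
  shows "(awalk_verts u p ! i, awalk_verts u p ! Suc i) \<in> arcs_ends G"
  using assms
proof (induction p arbitrary: u i)
  case (Cons e es)
  then have e: "e \<in> arcs G" "u = tail G e" "awalk (head G e) es v" by (simp_all add: awalk_Cons_iff)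
  show ?case
  proof (cases i)
    case 0
    have "awalk_verts (head G e) es ! 0 = head G e"
      using e(3) by (metis awalk_verts_non_Nil hd_conv_nth awhd_of_awalk)
    then show ?thesis using 0 e by (auto simp: arcs_ends_conv)
  next
    case (Suc j)
    then show ?thesis using Cons.IH[OF e(3), of j] Cons.prems by simp
  qed
qed simp

lemma (in wf_digraph) apath_path_list:
  assumes "apath u p v"
  shows "path_list (arcs_ends G) (awalk_verts u p)" "set (awalk_verts u p) \<subseteq> verts G"
  using assms awalk_consecutive unfolding apath_def path_list_def by auto

text \<open>The cut of \<open>uv\<close> is the set of nodes reachable from \<open>u\<close> after
  both arcs between \<open>u\<close> and \<open>v\<close> are deleted. Were \<open>v\<close>
  reachable, a path to it would have at least two arcs, and the arc from \<open>v\<close> to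
  \<open>u\<close> would close it to a cycle of length at least 3.\<close>

lemma utree_host_tree:
  assumes "utree T"
  shows "host_tree (verts T) (arcs_ends T)"
proof -
  interpret graph T using assms unfolding utree_def by blast
  have con: "connected T" and nocyc: "\<And>p. cycle p \<Longrightarrow> length p < 3"
    using assms unfolding utree_def by (auto simp: not_le)
  have sc: "strongly_connected T" using symmetric_connected_imp_strongly_connected[OF sym_arcs con] .
  show ?thesis
  proof
    show "finite (verts T)" by simp
    show "verts T \<noteq> {}" using sc unfolding strongly_connected_def by blast
    show "arcs_ends T \<subseteq> verts T \<times> verts T" using adj_in_verts by auto
    show "(v, u) \<in> arcs_ends T" if "(u, v) \<in> arcs_ends T" for u v
      using arcs_ends_symmetric[OF sym_arcs that] .
    show "(u, u) \<notin> arcs_ends T" for u using adj_not_same by blast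
    show "(u, v) \<in> (arcs_ends T)\<^sup>*" if "u \<in> verts T" "v \<in> verts T" for u v
      using reachable_rtranclI[of T u v] sc that unfolding strongly_connected_def by simp
    show "\<exists>S. edge_cut (arcs_ends T) u v S" if uv: "(u, v) \<in> arcs_ends T" for u v
    proof -
      let ?F = "arcs_ends T - {(u, v), (v, u)}"
      define T' where "T' = T\<lparr>arcs := {e \<in> arcs T. arc_to_ends T e \<notin> {(u, v), (v, u)}}\<rparr>"
      have T': "verts T' = verts T" "arcs T' \<subseteq> arcs T" "tail T' = tail T" "head T' = head T"
        "arcs T' = {e \<in> arcs T. arc_to_ends T e \<notin> {(u, v), (v, u)}}"
        unfolding T'_def by auto
      interpret T': wf_digraph T' by unfold_locales (use T' in auto)
      have sub: "subgraph T' T" using T' wf_digraph T'.wf_digraph by (intro subgraphI) (auto simp: compatible_def)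
      have ends: "arcs_ends T' = ?F"
        using T'(3,4,5) unfolding arcs_ends_def arc_to_ends_def by auto
      have uvV: "u \<in> verts T" "v \<in> verts T" "u \<noteq> v" using uv adj_in_verts adj_not_same by auto
      have notin: "(u, v) \<notin> ?F\<^sup>*"
      proof
        assume "(u, v) \<in> ?F\<^sup>*"
        then have "u \<rightarrow>\<^sup>*\<^bsub>T'\<^esub> v" using T'.reachable_conv' ends uvV T' by simp
        then obtain p where p: "T'.apath u p v" using T'.reachable_apath by blast
        then have ap: "apath u p v" using subgraph_apath_imp_apath sub by blast
        obtain e where e: "e \<in> arcs T" "tail T e = v" "head T e = u"
          using arcs_ends_symmetric[OF sym_arcs uv] by blast
        have "p \<noteq> []" using ap uvV(3) by (auto simp: apath_Nil_iff)
        moreover have "length p \<noteq> 1"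
        proof
          assume "length p = 1"
          then obtain x where "p = [x]" by (metis One_nat_def length_0_conv length_Suc_conv)
          then have "x \<in> arcs T'" "tail T' x = u" "head T' x = v" using p
            by (auto simp: T'.apath_Cons_iff T'.apath_Nil_iff)
          then show False using T' by (auto simp: arc_to_ends_def)
        qed
        ultimately have len: "length (p @ [e]) \<ge> 3" by (cases p) (auto simp: Suc_le_eq)
        have aw: "awalk u p v" and di: "distinct (awalk_verts u p)" using ap unfolding apath_def by auto
        have "awalk v [e] u" using e uvV by (simp add: awalk_Cons_iff awalk_Nil_iff)
        then have cl: "awalk u (p @ [e]) u" using aw awalk_appendI by blast
        have "awalk_verts u (p @ [e]) = awalk_verts u p @ [u]"
          using aw \<open>p \<noteq> []\<close> e awalk_verts_conv[of u "p @ [e]"] awalk_verts_conv[of u p]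
            awlast_of_awalk[OF aw] by simp
        moreover obtain ys where ys: "awalk_verts u p = u # ys"
          using aw by (metis awhd_of_awalk awalk_verts_non_Nil list.collapse)
        ultimately have "distinct (tl (awalk_verts u (p @ [e])))" using di by auto
        then have "cycle (p @ [e])" unfolding cycle_def using cl by blast
        then show False using nocyc len by (metis not_le)
      qed
      have "edge_cut (arcs_ends T) u v {x. (u, x) \<in> ?F\<^sup>*}"
        unfolding edge_cut_def
      proof (intro conjI allI impI; (elim conjE)?)
        show "u \<in> {x. (u, x) \<in> ?F\<^sup>*}" by simp
        show "v \<notin> {x. (u, x) \<in> ?F\<^sup>*}" using notin by simp
        fix x y assume xy: "(x, y) \<in> arcs_ends T" "x \<in> {x. (u, x) \<in> ?F\<^sup>*}" "y \<notin> {x. (u, x) \<in> ?F\<^sup>*}"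
        then have "(x, y) \<notin> ?F" by (metis mem_Collect_eq rtrancl.rtrancl_into_rtrancl)
        then have "(x, y) = (u, v) \<or> (x, y) = (v, u)" using xy(1) by blast
        then show "x = u" "y = v" using notin xy(2) by auto
      qed
      then show ?thesis by blast
    qed
  qed
qed

lemma utree_vpaths:
  assumes "utree T" "X \<in> vpaths T"
  shows "X \<subseteq> verts T" "path_in (arcs_ends T) X"
proof -
  interpret graph T using assms unfolding utree_def by blast
  obtain x p y where "apath x p y" "X = set (awalk_verts x p)"
    using assms(2) unfolding vpaths_def by blast
  then show "X \<subseteq> verts T" "path_in (arcs_ends T) X"
    using apath_path_list[of x p y] unfolding path_in_def by auto
qed

lemma utree_nbrs_le_degree:
  assumes "utree T"
  shows "card (arcs_ends T `` {x}) \<le> out_degree T x"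
proof -
  interpret graph T using assms unfolding utree_def by blast
  have "arcs_ends T `` {x} \<subseteq> head T ` out_arcs T x" by (auto simp: arcs_ends_conv)
  then have "card (arcs_ends T `` {x}) \<le> card (head T ` out_arcs T x)"
    by (intro card_mono) auto
  also have "\<dots> \<le> out_degree T x" unfolding out_degree_def by (intro card_image_le) auto
  finally show ?thesis .
qed

definition digraph_of :: "'t set \<Rightarrow> ('t \<times> 't) set \<Rightarrow> ('t, 't \<times> 't) pre_digraph" where
  "digraph_of V E = with_proj \<lparr> pverts = V, parcs = E \<rparr>"

lemma digraph_of_simps [simp]:
  "verts (digraph_of V E) = V" "arcs (digraph_of V E) = E" "arcs_ends (digraph_of V E) = E"
  "tail (digraph_of V E) = fst" "head (digraph_of V E) = snd"
  unfolding digraph_of_def by simp_all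

context host_tree
begin

lemma graph_digraph_of: "graph (digraph_of V E)"
proof
  show "finite (arcs (digraph_of V E))" using finV EV by (simp add: finite_subset)
  show "symmetric (digraph_of V E)" unfolding symmetric_def using symE by (auto simp: sym_def)
qed (use EV finV irrE in \<open>auto simp: arc_to_ends_def\<close>)

lemma path_in_vpaths:
  assumes "path_in E X" "X \<subseteq> V"
  shows "X \<in> vpaths (digraph_of V E)"
proof -
  interpret graph "digraph_of V E" by (rule graph_digraph_of)
  have walk: "\<exists>p. awalk x p (last (x # xs)) \<and> awalk_verts x p = x # xs"
    if "path_list E (x # xs)" "set (x # xs) \<subseteq> V" for x xs
    using that
  proof (induction xs arbitrary: x)
    case Nil
    then show ?case by (intro exI[of _ "[]"]) (simp add: awalk_Nil_iff)
  next
    case (Cons y ys)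
    have "\<And>i. Suc i < length (y # ys) \<Longrightarrow> ((x # y # ys) ! Suc i, (x # y # ys) ! Suc (Suc i)) \<in> E"
      using Cons.prems(1) unfolding path_list_def by (metis Suc_less_eq length_Cons)
    then have "path_list E (y # ys)" using Cons.prems(1) unfolding path_list_def by simp
    then obtain p where "awalk y p (last (y # ys))" "awalk_verts y p = y # ys"
      using Cons.IH[of y] Cons.prems by auto
    moreover have "(x, y) \<in> E" using Cons.prems(1) unfolding path_list_def by force
    ultimately show ?case by (intro exI[of _ "(x, y) # p"]) (simp add: awalk_Cons_iff)
  qed
  obtain xs where xs: "path_list E xs" "set xs = X" using assms unfolding path_in_def by blast
  obtain x ys where "xs = x # ys" using xs(1) unfolding path_list_def by (meson list.exhaust)
  then obtain p where "awalk x p (last xs)" "awalk_verts x p = xs" using walk xs assms(2) by blast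
  moreover have "distinct xs" using xs(1) unfolding path_list_def by simp
  ultimately have "apath x p (last xs)" "set (awalk_verts x p) = X"
    unfolding apath_def using xs by auto
  then show ?thesis unfolding vpaths_def by blast
qed

text \<open>Without its first arc, a cycle of length at least 3 is a path on at least three nodes
  with adjacent ends \<open>v\<close> and \<open>u\<close>. These two ends form a convex set, which
  would have to contain the second node of the path.\<close>

lemma utree_digraph_of: "utree (digraph_of V E)"
proof -
  interpret graph "digraph_of V E" by (rule graph_digraph_of)
  have "connected (digraph_of V E)"
    unfolding connected_conv
  proof (intro conjI ballI)
    show "verts (digraph_of V E) \<noteq> {}" using neV by simp
    fix u v assume uv: "u \<in> verts (digraph_of V E)" "v \<in> verts (digraph_of V E)"
    then have "reachable (digraph_of V E) u v" using reach reachable_conv' by simp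
    then show "(u, v) \<in> rtrancl_on (verts (digraph_of V E)) ((arcs_ends (digraph_of V E))\<^sup>s)"
      unfolding reachable_def by (rule rtrancl_on_mono[rotated -1]) (auto simp: symcl_def)
  qed
  moreover have "length p < 3" if cyc: "cycle p" for p
  proof (rule ccontr)
    assume "\<not> length p < 3"
    obtain u where u: "awalk u p u" "distinct (tl (awalk_verts u p))" "p \<noteq> []"
      using cyc unfolding cycle_def by blast
    then obtain e p' where p: "p = e # p'" by (meson list.exhaust)
    define v xs where "v = snd e" and "xs = awalk_verts v p'"
    have aw: "awalk v p' u" and uv: "(u, v) \<in> E" and d: "distinct xs"
      using u p by (auto simp: awalk_Cons_iff v_def xs_def)
    have len: "length xs \<ge> 3" using \<open>\<not> length p < 3\<close> p by (simp add: xs_def length_awalk_verts)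
    then have ne: "xs \<noteq> []" by auto
    have pl: "path_list E xs"
      using apath_path_list(1)[of v p' u] aw d unfolding apath_def xs_def by simp
    have h: "xs ! 0 = v" 
      using awhd_of_awalk[OF aw] hd_conv_nth[of xs] len unfolding xs_def by auto
    have l: "xs ! (length xs - 1) = u" 
      using awlast_of_awalk[OF aw] last_conv_nth[of xs] len unfolding xs_def by auto
    have "convex_in E {u, v}" using uv by (simp add: conn_convex conn_edgeI symE)
    then have "xs ! 1 \<in> {u, v}"
      using path_list_between[OF pl, of 0 1 "length xs - 1" "{u, v}"] h l len by auto
    moreover have "xs ! 1 \<noteq> xs ! 0" "xs ! 1 \<noteq> xs ! (length xs - 1)"
      using nth_eq_iff_index_eq[OF d, of 1 0] nth_eq_iff_index_eq[OF d, of 1 "length xs - 1"] len ne by auto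
    ultimately show False using h l by auto
  qed
  ultimately show ?thesis unfolding utree_def using graph_digraph_of by (metis not_le)
qed

end

section \<open>Translation between VPT representations and models\<close>

lemma vpt_representation_model:
  assumes "vpt_representation G T P"
  shows "model (verts G) (dominates G) (verts T) (arcs_ends T) P"
proof -
  have T: "utree T" and P: "\<And>v. v \<in> verts G \<Longrightarrow> P v \<in> vpaths T"
    and A: "\<forall>u\<in>verts G. \<forall>v\<in>verts G. u \<noteq> v \<longrightarrow> (u \<rightarrow>\<^bsub>G\<^esub> v \<longleftrightarrow> P u \<inter> P v \<noteq> {})"
    using assms unfolding vpt_representation_def by auto
  interpret host_tree "verts T" "arcs_ends T" using utree_host_tree[OF T] .
  have "P u \<subseteq> verts T \<and> P u \<noteq> {} \<and> conn (arcs_ends T) (P u) \<and> narrow (arcs_ends T) (P u)"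
    if "u \<in> verts G" for u
    using utree_vpaths[OF T P[OF that]] path_in_conn path_in_narrow path_in_finite by auto
  then show ?thesis using A host_tree_axioms unfolding model_def by blast
qed

lemma model_vpt_representation:
  assumes "model (verts G) (dominates G) V E P"
  shows "vpt_representation G (digraph_of V E) P"
proof -
  interpret host_tree V E using assms unfolding model_def by blast
  have "P u \<in> vpaths (digraph_of V E)" if "u \<in> verts G" for u
  proof -
    have P: "P u \<subseteq> V" "P u \<noteq> {}" "conn E (P u)" "narrow E (P u)"
      using assms that unfolding model_def by blast+
    then have "finite (P u)" using finV finite_subset by blast
    then show ?thesis using P narrow_path_in path_in_vpaths by blast
  qed
  then show ?thesis
    using assms utree_digraph_of unfolding vpt_representation_def model_def by simp
qed

lemma out_degree_digraph_of: "out_degree (digraph_of V E) x = card (E `` {x})"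
proof -
  have "snd ` out_arcs (digraph_of V E) x = E `` {x}" by (force simp: out_arcs_def)
  moreover have "inj_on snd (out_arcs (digraph_of V E) x)" by (auto simp: inj_on_def out_arcs_def)
  ultimately show ?thesis unfolding out_degree_def by (metis card_image)
qed

section \<open>Branch graphs and host trees\<close>

text \<open>An edge \<open>qa\<close> such that every path through \<open>a\<close> contains
  \<open>q\<close> can be contracted without changing the intersection pattern. Each contraction
  removes a node, so the process ends.\<close>

lemma model_reduced:
  assumes "model U A (V :: 't set) E P"
  shows "\<exists>(V :: 't set) E P. model U A V E P \<and> (\<forall>q a. (q, a) \<in> E \<longrightarrow> (\<exists>v\<in>U. a \<in> P v \<and> q \<notin> P v))"
  using assms
proof (induction "card V" arbitrary: V E P rule: less_induct)
  case less
  interpret host_tree V E using less.prems unfolding model_def by blast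
  show ?case
  proof (cases "\<forall>q a. (q, a) \<in> E \<longrightarrow> (\<exists>v\<in>U. a \<in> P v \<and> q \<notin> P v)")
    case True
    then show ?thesis using less.prems by blast
  next
    case False
    then obtain q a where qa: "(q, a) \<in> E" "\<forall>u\<in>U. a \<in> P u \<longrightarrow> q \<in> P u" by blast
    have "card (V - {a}) < card V" using qa(1) EV finV by (intro psubset_card_mono) auto
    then show ?thesis using less.hyps model_contract[OF less.prems qa(1)] qa(2) by blast
  qed
qed

lemma model_pathD:
  assumes "model U A V E P" "u \<in> U"
  shows "P u \<subseteq> V" "P u \<noteq> {}" "convex_in E (P u)" "path_in E (P u)"
proof -
  interpret host_tree V E using assms unfolding model_def by blast
  have P: "P u \<subseteq> V" "P u \<noteq> {}" "conn E (P u)" "narrow E (P u)"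
    using assms unfolding model_def by blast+
  then show "P u \<subseteq> V" "P u \<noteq> {}" by simp_all
  show "convex_in E (P u)" by (rule conn_convex[OF P(3)])
  show "path_in E (P u)" using narrow_path_in[OF P(3,4) finite_subset[OF P(1) finV] P(2)] .
qed

lemma complete_setI_insert:
  assumes "graph G" "complete_set G C" "v \<in> verts G" "\<And>x. x \<in> C \<Longrightarrow> x \<noteq> v \<Longrightarrow> x \<rightarrow>\<^bsub>G\<^esub> v"
  shows "complete_set G (insert v C)"
proof -
  interpret graph G by fact
  have "v \<rightarrow>\<^bsub>G\<^esub> x" if "x \<in> C" "x \<noteq> v" for x
    using assms(4)[OF that] arcs_ends_symmetric[OF sym_arcs] by blast
  then show ?thesis using assms(2-4) unfolding complete_set_def by auto
qed

text \<open>The Helly property for the pairwise intersecting paths of \<open>C\<close>; for empty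
  \<open>C\<close> any node will do.\<close>

lemma complete_set_common_node:
  assumes m: "model (verts G) (dominates G) V E P" and C: "complete_set G C" "finite C"
  shows "\<exists>q\<in>V. \<forall>x\<in>C. q \<in> P x"
proof -
  interpret host_tree V E using m unfolding model_def by blast
  show ?thesis
  proof (cases "C = {}")
    case True
    then show ?thesis using neV by blast
  next
    case False
    have P: "P u \<subseteq> V" "P u \<noteq> {}" "convex_in E (P u)" if "u \<in> C" for u
      using model_pathD[OF m, of u] C(1) that unfolding complete_set_def by auto
    have "\<Inter>(P ` C) \<noteq> {}"
    proof (rule helly)
      show "finite (P ` C)" "P ` C \<noteq> {}" using C False by auto
      show "convex_in E Q \<and> Q \<subseteq> V \<and> Q \<noteq> {}" if "Q \<in> P ` C" for Q using P that by blast
      show "Q \<inter> R \<noteq> {}" if QR: "Q \<in> P ` C" "R \<in> P ` C" for Q R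
      proof -
        obtain x y where xy: "x \<in> C" "y \<in> C" "Q = P x" "R = P y" using QR by blast
        show ?thesis
        proof (cases "x = y")
          case True
          then show ?thesis using P(2)[OF xy(1)] xy by simp
        next
          case False
          then have "x \<rightarrow>\<^bsub>G\<^esub> y" "x \<in> verts G" "y \<in> verts G" using C(1) xy unfolding complete_set_def by auto
          then show ?thesis using m False xy unfolding model_def by blast
        qed
      qed
    qed
    then obtain q where "\<forall>x\<in>C. q \<in> P x" by blast
    then show ?thesis using P(1) False by blast
  qed
qed

lemma clique_finite: "graph G \<Longrightarrow> C \<in> cliques G \<Longrightarrow> finite C"
  unfolding cliques_def complete_set_def graph_def digraph_def
  by (metis (no_types, lifting) fin_digraph.finite_verts finite_subset mem_Collect_eq)

text \<open>A vertex outside \<open>C\<close> whose path contains the common node could be added to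
  \<open>C\<close>, against maximality.\<close>

lemma clique_center:
  assumes G: "graph G" and m: "model (verts G) (dominates G) V E P" and C: "C \<in> cliques G"
  obtains q where "q \<in> V" "\<And>x. x \<in> C \<Longrightarrow> q \<in> P x" "\<And>v. v \<in> verts G - C \<Longrightarrow> q \<notin> P v"
proof -
  have cC: "complete_set G C" and mx: "\<And>D. complete_set G D \<Longrightarrow> C \<subseteq> D \<Longrightarrow> D = C"
    using C unfolding cliques_def by auto
  obtain q where q: "q \<in> V" "\<forall>x\<in>C. q \<in> P x"
    using complete_set_common_node[OF m cC clique_finite[OF G C]] by blast
  have "q \<notin> P v" if v: "v \<in> verts G - C" for v
  proof
    assume "q \<in> P v"
    then have "x \<rightarrow>\<^bsub>G\<^esub> v" if "x \<in> C" "x \<noteq> v" for x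
      using m that v q(2) cC unfolding model_def complete_set_def by blast
    then have "complete_set G (insert v C)" using complete_setI_insert[OF G cC] v by blast
    then show False using mx[of "insert v C"] v by blast
  qed
  then show thesis using that q by blast
qed

lemma branch_graph_verts [simp]: "verts (branch_graph G C) = branch_verts G C"
  unfolding branch_graph_def by simp

lemma branch_graph_adj:
  "v \<rightarrow>\<^bsub>branch_graph G C\<^esub> w \<longleftrightarrow> v \<in> branch_verts G C \<and> w \<in> branch_verts G C \<and> \<not> v \<rightarrow>\<^bsub>G\<^esub> w \<and>
     (\<exists>x\<in>C. x \<rightarrow>\<^bsub>G\<^esub> v \<and> x \<rightarrow>\<^bsub>G\<^esub> w) \<and> (\<exists>y\<in>C. y \<rightarrow>\<^bsub>G\<^esub> v \<and> \<not> y \<rightarrow>\<^bsub>G\<^esub> w) \<and>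
     (\<exists>z\<in>C. z \<rightarrow>\<^bsub>G\<^esub> w \<and> \<not> z \<rightarrow>\<^bsub>G\<^esub> v)"
  unfolding branch_graph_def by simp

text \<open>The part of \<open>S\<close> inside \<open>V\<close> is convex and contains
  \<open>u\<close>. A node of it outside \<open>T\<close> would be separated from \<open>u\<close>
  by the edge \<open>uv\<close>, which would put \<open>v\<close> into \<open>S\<close>.\<close>

lemma (in host_tree) cut_side_unique:
  assumes "edge_cut E u v S" "edge_cut E u v T" "(u, v) \<in> E"
  shows "S \<inter> V \<subseteq> T"
proof
  fix z assume z: "z \<in> S \<inter> V"
  have uv: "u \<in> S \<inter> V" "v \<notin> S" "u \<in> T" using assms EV unfolding edge_cut_def by auto
  show "z \<in> T"
    using convex_inD[OF conn_convex[OF conn_cut_side[OF assms(1,3)]] assms(3,2) uv(1) z uv(3)] uv(2) by blast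
qed

text \<open>The direction comes from the edge separating \<open>q\<close> from \<open>X\<close>. All
  cuts of this edge are covered, so that two sets in the same direction can be compared on a single
  cut.\<close>

lemma (in host_tree) branch_direction:
  assumes q: "q \<in> V" and X: "convex_in E X" "X \<subseteq> V" "X \<noteq> {}" "q \<notin> X"
  obtains a where "(q, a) \<in> E" "\<And>S. edge_cut E q a S \<Longrightarrow> X \<inter> S = {}"
proof -
  have q1: "convex_in E {q}" by (rule convex_inI) auto
  obtain u a T where T: "(u, a) \<in> E" "edge_cut E u a T" "u \<in> {q}" "X \<inter> T = {}"
    by (rule separation[OF q1 _ _ X(1,3,2)]) (use q X in auto)
  then have u: "u = q" by simp
  show thesis
  proof (rule that)
    show "(q, a) \<in> E" using T u by simp
    show "X \<inter> S = {}" if "edge_cut E q a S" for S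
      using cut_side_unique[of q a S T] that T u X(2) by auto
  qed
qed

text \<open>Two vertices whose paths lie in the same direction from \<open>q\<close> have nested
  neighbourhoods in \<open>C\<close> as soon as they share a neighbour there; so they are not joined
  in the branch graph.\<close>

lemma clique_model_same_branch:
  assumes G: "graph G" and m: "model (verts G) (dominates G) V E P" and C: "C \<in> cliques G"
    and q: "\<And>x. x \<in> C \<Longrightarrow> q \<in> P x"
    and qa: "(q, a) \<in> E" "edge_cut E q a S"
    and v: "v \<in> verts G - C" "P v \<inter> S = {}" and w: "w \<in> verts G - C" "P w \<inter> S = {}"
    and x: "x \<in> C" "x \<rightarrow>\<^bsub>G\<^esub> v" "x \<rightarrow>\<^bsub>G\<^esub> w" and y: "y \<in> C" "y \<rightarrow>\<^bsub>G\<^esub> v" and z: "z \<in> C" "z \<rightarrow>\<^bsub>G\<^esub> w"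
  shows "y \<rightarrow>\<^bsub>G\<^esub> w \<or> z \<rightarrow>\<^bsub>G\<^esub> v"
proof -
  interpret host_tree V E using m unfolding model_def by blast
  have CV: "C \<subseteq> verts G" using C unfolding cliques_def complete_set_def by blast
  have adj: "u \<rightarrow>\<^bsub>G\<^esub> t \<longleftrightarrow> P u \<inter> P t \<noteq> {}" if "u \<in> C" "t \<in> verts G - C" for u t
  proof -
    have "u \<in> verts G" "t \<in> verts G" "u \<noteq> t" using that CV by auto
    then show ?thesis using m unfolding model_def by blast
  qed
  have "x \<in> verts G" "y \<in> verts G" "z \<in> verts G" "v \<in> verts G" "w \<in> verts G"
    using x y z v w CV by auto
  note P = this[THEN model_pathD(1)[OF m]] this[THEN model_pathD(3)[OF m]] this(1)[THEN model_pathD(4)[OF m]]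
  have "P y \<inter> P w \<noteq> {} \<or> P z \<inter> P v \<noteq> {}"
    by (rule same_branch_nested[OF qa P(9,4) v(2) P(10,5) w(2) P(11) q[OF x(1)] _ _ P(7) q[OF y(1)] _ P(8) q[OF z(1)]])
      (use x y z v w adj in auto)
  then show ?thesis using adj v w y z by blast
qed

lemma in_h21_branch_colorable:
  assumes G: "graph G" and h: "in_h21 h G" and C: "C \<in> cliques G"
  shows "\<exists>c. proper_coloring (branch_graph G C) h c"
proof -
  obtain T :: "(nat, nat \<times> nat) pre_digraph" and P where
    T: "vpt_representation G T P" "\<forall>x\<in>verts T. out_degree T x \<le> h"
    using h unfolding in_h21_def by blast
  let ?V = "verts T" and ?E = "arcs_ends T"
  have m: "model (verts G) (dominates G) ?V ?E P" using vpt_representation_model[OF T(1)] .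
  interpret host_tree ?V ?E using m unfolding model_def by blast
  obtain q where q: "q \<in> ?V" "\<And>x. x \<in> C \<Longrightarrow> q \<in> P x" "\<And>v. v \<in> verts G - C \<Longrightarrow> q \<notin> P v"
    using clique_center[OF G m C] by blast
  have "utree T" using T unfolding vpt_representation_def by blast
  then have deg: "card (?E `` {q}) \<le> h" using utree_nbrs_le_degree[of T q] T(2) q(1) by (meson le_trans)
  \<comment> \<open>\<open>g\<close> numbers the at most \<open>h\<close> directions at
    \<open>q\<close>, and \<open>f\<close> below maps a vertex to the direction of its path; the
    colouring is their composition.\<close>
  obtain g where g: "inj_on g (?E `` {q})" "g ` (?E `` {q}) \<subseteq> {..<h}"
    using card_le_inj[of "?E `` {q}" "{..<h}"] finite_nbrs[of q] deg by auto
  have "\<exists>a. (q, a) \<in> ?E \<and> (\<forall>S. edge_cut ?E q a S \<longrightarrow> P v \<inter> S = {})" if v: "v \<in> branch_verts G C" for v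
  proof -
    have v': "v \<in> verts G" "q \<notin> P v" using v q(3) unfolding branch_verts_def by auto
    obtain a where "(q, a) \<in> ?E" "\<And>S. edge_cut ?E q a S \<Longrightarrow> P v \<inter> S = {}"
      using branch_direction[OF q(1) model_pathD(3,1,2)[OF m v'(1)] v'(2)] by metis
    then show ?thesis by blast
  qed
  then obtain f where f: "\<And>v. v \<in> branch_verts G C \<Longrightarrow> (q, f v) \<in> ?E"
    "\<And>v S. v \<in> branch_verts G C \<Longrightarrow> edge_cut ?E q (f v) S \<Longrightarrow> P v \<inter> S = {}"
    by metis
  have "proper_coloring (branch_graph G C) h (g \<circ> f)"
    unfolding proper_coloring_def
  proof (intro conjI ballI allI impI)
    show "(g \<circ> f) v < h" if "v \<in> verts (branch_graph G C)" for v using f(1)[of v] g(2) that by auto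
    fix v w assume vw: "v \<rightarrow>\<^bsub>branch_graph G C\<^esub> w"
    then obtain x y z where b: "v \<in> branch_verts G C" "w \<in> branch_verts G C"
      and x: "x \<in> C" "x \<rightarrow>\<^bsub>G\<^esub> v" "x \<rightarrow>\<^bsub>G\<^esub> w" and y: "y \<in> C" "y \<rightarrow>\<^bsub>G\<^esub> v" "\<not> y \<rightarrow>\<^bsub>G\<^esub> w"
      and z: "z \<in> C" "z \<rightarrow>\<^bsub>G\<^esub> w" "\<not> z \<rightarrow>\<^bsub>G\<^esub> v"
      unfolding branch_graph_adj by blast
    show "(g \<circ> f) v \<noteq> (g \<circ> f) w"
    proof
      assume "(g \<circ> f) v = (g \<circ> f) w"
      then have fe: "f v = f w" using g(1) f(1)[OF b(1)] f(1)[OF b(2)] unfolding inj_on_def by auto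
      obtain S where S: "edge_cut ?E q (f v) S" using cuts f(1)[OF b(1)] by blast
      have o: "v \<in> verts G - C" "w \<in> verts G - C" using b unfolding branch_verts_def by auto
      show False
        using clique_model_same_branch[OF G m C q(2) f(1)[OF b(1)] S o(1) f(2)[OF b(1) S] o(2) _ x y(1,2) z(1,2)]
          f(2)[OF b(2)] S fe y(3) z(3) by simp
    qed
  qed
  then show ?thesis by blast
qed

text \<open>A larger complete set \<open>D\<close> has a common node \<open>p\<close> by the Helly
  property. If \<open>p\<close> differs from \<open>q\<close>, let \<open>a\<close> be the neighbour
  of \<open>q\<close> towards \<open>p\<close>. Reducedness yields a path with \<open>q\<close> but
  not \<open>a\<close>; it belongs to \<open>D\<close>, hence contains \<open>p\<close>, and
  convexity forces \<open>a\<close> into it.\<close>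

lemma reduced_node_clique:
  assumes G: "graph G" and m: "model (verts G) (dominates G) V E P"
    and red: "\<And>q a. (q, a) \<in> E \<Longrightarrow> \<exists>v\<in>verts G. a \<in> P v \<and> q \<notin> P v" and q: "q \<in> V"
  shows "{v \<in> verts G. q \<in> P v} \<in> cliques G"
proof -
  interpret host_tree V E using m unfolding model_def by blast
  interpret G: graph G by (rule G)
  let ?C = "{v \<in> verts G. q \<in> P v}"
  have "complete_set G ?C" using m unfolding complete_set_def model_def by blast
  moreover have "D = ?C" if D: "complete_set G D" "?C \<subseteq> D" for D
  proof -
    have "finite D" using D(1) G.finite_verts finite_subset unfolding complete_set_def by blast
    then obtain p where p: "p \<in> V" "\<forall>x\<in>D. p \<in> P x" using complete_set_common_node[OF m D(1)] by blast
    have "p = q"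
    proof (rule ccontr)
      assume "p \<noteq> q"
      have 1: "convex_in E {p}" by (rule convex_inI) auto
      obtain a where a: "(q, a) \<in> E" "\<And>S. edge_cut E q a S \<Longrightarrow> {p} \<inter> S = {}"
        using branch_direction[OF q 1] p(1) \<open>p \<noteq> q\<close> by blast
      obtain S where S: "edge_cut E q a S" using cuts a by blast
      obtain v where v: "v \<in> verts G" "q \<in> P v" "a \<notin> P v" using red[OF symE[OF a(1)]] by blast
      then have "p \<in> P v" using p D(2) by blast
      moreover have "convex_in E (P v)" using model_pathD(3)[OF m v(1)] .
      moreover have "q \<in> S" "p \<notin> S" using S a(2)[OF S] unfolding edge_cut_def by auto
      ultimately show False using convex_inD[of E "P v" q a S q p] a(1) S v by blast
    qed
    then show ?thesis using p D unfolding complete_set_def by blast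
  qed
  ultimately show ?thesis unfolding cliques_def by blast
qed

text \<open>If every path through \<open>q\<close> and \<open>a\<close> continues to \<open>b\<close>, then \<open>b\<close> is the only direction in conflict
  with \<open>a\<close>, and a second colour always suffices for \<open>a\<close>; the remaining directions inherit the colours
  of witnesses in the branch graph.\<close>

lemma reduced_branch_colorable:
  fixes V :: "nat set"
  assumes m: "model (verts G) (dominates G) V E P"
    and red: "\<And>q a. (q, a) \<in> E \<Longrightarrow> \<exists>v\<in>verts G. a \<in> P v \<and> q \<notin> P v"
    and C: "C = {v \<in> verts G. q \<in> P v}" and c: "proper_coloring (branch_graph G C) h c" and h: "h \<ge> 2"
  shows "branch_colorable (verts G) h E P q"
proof -
  interpret host_tree V E using m unfolding model_def by blast
  obtain w where w: "\<And>a. (q, a) \<in> E \<Longrightarrow> w a \<in> verts G" "\<And>a. (q, a) \<in> E \<Longrightarrow> a \<in> P (w a)"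
    "\<And>a. (q, a) \<in> E \<Longrightarrow> q \<notin> P (w a)"
    using red by metis
  have adj: "u \<rightarrow>\<^bsub>G\<^esub> v \<longleftrightarrow> P u \<inter> P v \<noteq> {}" if "u \<in> verts G" "v \<in> verts G" "u \<noteq> v" for u v
    using m that unfolding model_def by blast
  have beyond: "P (w a) \<inter> S = {}" if a: "(q, a) \<in> E" and S: "edge_cut E q a S" for a S
    using convex_inD[OF model_pathD(3)[OF m w(1)[OF a]] a S, of _ a] w(2,3)[OF a] S
    unfolding edge_cut_def by blast
  \<comment> \<open>The path of \<open>w a\<close> lies beyond the edge \<open>qa\<close>, so a path
    through \<open>q\<close> meets it exactly if it passes through \<open>a\<close>.\<close>
  have wadj: "x \<rightarrow>\<^bsub>G\<^esub> w a \<longleftrightarrow> a \<in> P x" if x: "x \<in> C" and a: "(q, a) \<in> E" for x a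
  proof -
    have xG: "x \<in> verts G" "q \<in> P x" "x \<noteq> w a" using x w(3)[OF a] unfolding C by auto
    obtain S where S: "edge_cut E q a S" using cuts a by blast
    have "a \<in> P x" if z: "z \<in> P x" "z \<in> P (w a)" for z
      using convex_inD[OF model_pathD(3)[OF m xG(1)] a S xG(2) z(1)] S beyond[OF a S] z(2)
      unfolding edge_cut_def by blast
    then show ?thesis using adj[OF xG(1) w(1)[OF a] xG(3)] w(2)[OF a] by blast
  qed
  have nadj: "\<not> w a \<rightarrow>\<^bsub>G\<^esub> w b" if ab: "(q, a) \<in> E" "(q, b) \<in> E" "a \<noteq> b" for a b
  proof -
    obtain S where S: "edge_cut E q a S" using cuts ab by blast
    then have b: "b \<in> S" "a \<notin> S" using ab unfolding edge_cut_def by blast+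
    have "P (w b) \<subseteq> S"
      using convex_inD[OF model_pathD(3)[OF m w(1)[OF ab(2)]] ab(1) S w(2)[OF ab(2)] _ b(1)] w(3)[OF ab(2)]
      by blast
    then have d: "P (w a) \<inter> P (w b) = {}" using beyond[OF ab(1) S] by blast
    then have "w a \<noteq> w b" using w(2)[OF ab(1)] by auto
    then show ?thesis using adj[OF w(1)[OF ab(1)] w(1)[OF ab(2)]] d by simp
  qed
  have two: "a = b \<or> b = e \<or> a = e"
    if "x \<in> C" "a \<in> P x" "b \<in> P x" "e \<in> P x" "(q, a) \<in> E" "(q, b) \<in> E" "(q, e) \<in> E" for x a b e
  proof -
    have "narrow E (P x)" "q \<in> P x" using m that(1) unfolding C model_def by blast+
    then show ?thesis using that(2-) unfolding narrow_def by blast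
  qed
  define N where "N a = {x \<in> C. a \<in> P x}" for a
  define dom where "dom a b \<longleftrightarrow> (q, a) \<in> E \<and> (q, b) \<in> E \<and> a \<noteq> b \<and> N a \<subseteq> N b" for a b
  \<comment> \<open>A direction on no path of \<open>C\<close> gets the default 0. If
    \<open>b\<close> dominates \<open>a\<close>, it is the only conflict of \<open>a\<close>: when
    the domination is mutual, the order of the nodes hands out 0 and 1; otherwise \<open>a\<close>
    takes one of 0 and 1 that differs from the colour of the witness of \<open>b\<close>. All other
    directions take the colour of their witness.\<close>
  define d where "d a = (if N a = {} then 0 else if \<exists>b. dom a b
      then let b = SOME b. dom a b in
        if \<exists>b'. dom b b' then (if a < b then 0 else 1) else if c (w b) = 0 then 1 else 0
      else c (w a))" for a
  have wB: "w a \<in> branch_verts G C" if "(q, a) \<in> E" "x \<in> N a" for a x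
  proof -
    have x: "x \<in> C" "x \<in> verts G" "a \<in> P x" using that(2) unfolding N_def C by auto
    have "w a \<notin> C" using w(3)[OF that(1)] unfolding C by simp
    moreover from this have "w a \<noteq> x" using x by auto
    then have "w a \<rightarrow>\<^bsub>G\<^esub> x" using adj[OF w(1)[OF that(1)] x(2)] w(2)[OF that(1)] x(3) by blast
    ultimately show ?thesis using x(1) w(1)[OF that(1)] unfolding branch_verts_def by blast
  qed
  have lt: "d a < h" if a: "(q, a) \<in> E" for a
  proof (cases "N a = {} \<or> (\<exists>b. dom a b)")
    case True
    then show ?thesis using h unfolding d_def Let_def by auto
  next
    case False
    then have "w a \<in> branch_verts G C" using wB[OF a] by blast
    then show ?thesis using False c unfolding d_def proper_coloring_def by auto
  qed
  have uniq: "b' = b" if "dom a b'" "x \<in> C" "a \<in> P x" "b \<in> P x" "a \<noteq> b" "(q, b) \<in> E" for a b b' x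
  proof -
    have "b' \<in> P x" using that(1,2,3) unfolding dom_def N_def by blast
    then show ?thesis using two[of x a b b'] that unfolding dom_def by blast
  qed
  have half: "d a \<noteq> d b"
    if x: "x \<in> C" "a \<in> P x" "b \<in> P x" "a \<noteq> b" "(q, a) \<in> E" "(q, b) \<in> E" and D: "\<exists>e. dom a e" for a b x
  proof -
    have ab: "dom a e \<longleftrightarrow> e = b" for e using uniq[OF _ x(1,2,3,4,6)] D by blast
    then have dom_a: "dom a = (\<lambda>e. e = b)" by blast
    have ba: "dom b e \<Longrightarrow> e = a" for e using uniq[OF _ x(1,3,2) _ x(5)] x(4) by blast
    have ne: "N a \<noteq> {}" "N b \<noteq> {}" using x unfolding N_def by blast+
    have da: "d a = (if \<exists>b'. dom b b' then (if a < b then 0 else 1) else if c (w b) = 0 then 1 else 0)"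
      using ne(1) unfolding d_def dom_a by simp
    show ?thesis
    proof (cases "\<exists>b'. dom b b'")
      case True
      then have dom_b: "dom b = (\<lambda>e. e = a)" using ba by blast
      have "d b = (if b < a then 0 else 1)" using ne(2) by (simp add: d_def dom_b dom_a)
      then show ?thesis using da True x(4) by auto
    next
      case False
      then have "d b = c (w b)" using ne(2) unfolding d_def by (simp only: if_False)
      then show ?thesis using da False by simp
    qed
  qed
  have "d a \<noteq> d b" if v: "v \<in> verts G" "a \<in> P v" "b \<in> P v" "q \<in> P v" "a \<noteq> b" "(q, a) \<in> E" "(q, b) \<in> E" for v a b
  proof -
    have vC: "v \<in> C" using v unfolding C by blast
    consider "\<exists>e. dom a e" | "\<exists>e. dom b e" | "\<not> (\<exists>e. dom a e)" "\<not> (\<exists>e. dom b e)" by blast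
    then show ?thesis
    proof cases
      case 1
      then show ?thesis using half[OF vC v(2,3,5-7)] by blast
    next
      case 2
      then show ?thesis using half[OF vC v(3,2) v(5)[symmetric] v(7,6)] by simp
    next
      case 3
      then obtain y z where y: "y \<in> C" "a \<in> P y" "b \<notin> P y" and z: "z \<in> C" "b \<in> P z" "a \<notin> P z"
        using v(5-7) unfolding dom_def N_def by blast
      have N: "v \<in> N a" "v \<in> N b" using vC v unfolding N_def by auto
      \<comment> \<open>As neither direction dominates the other, \<open>y\<close> and
        \<open>z\<close> are private neighbours of the two witnesses in \<open>C\<close>, and
        \<open>v\<close> is a common one.\<close>
      have "w a \<rightarrow>\<^bsub>branch_graph G C\<^esub> w b"
        unfolding branch_graph_adj
        using wB[OF v(6) N(1)] wB[OF v(7) N(2)] nadj[OF v(6,7,5)] wadj[OF _ v(6)] wadj[OF _ v(7)] vC v(2,3) y z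
        by blast
      then have "c (w a) \<noteq> c (w b)" using c unfolding proper_coloring_def by blast
      moreover have "d a = c (w a)" "d b = c (w b)"
        using N 3 unfolding d_def by (simp_all only: if_False empty_iff) auto
      ultimately show ?thesis by simp
    qed
  qed
  then show ?thesis unfolding branch_colorable_def using lt by blast
qed

lemma in_h21I:
  assumes G: "graph G" and vpt: "VPT G" and h: "h \<ge> 3"
    and col: "\<And>C. C \<in> cliques G \<Longrightarrow> \<exists>c. proper_coloring (branch_graph G C) h c"
  shows "in_h21 h G"
proof -
  obtain T :: "(nat, nat \<times> nat) pre_digraph" and P0 where "vpt_representation G T P0"
    using vpt unfolding VPT_def by blast
  from model_reduced[OF vpt_representation_model[OF this]]
  obtain V :: "nat set" and E P where m: "model (verts G) (dominates G) V E P"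
    and red: "\<And>q a. (q, a) \<in> E \<Longrightarrow> \<exists>v\<in>verts G. a \<in> P v \<and> q \<notin> P v" by blast
  have "branch_colorable (verts G) h E P q" if qV: "q \<in> V" for q
  proof -
    obtain c where "proper_coloring (branch_graph G {v \<in> verts G. q \<in> P v}) h c"
      using col[OF reduced_node_clique[OF G m red qV]] by blast
    then show ?thesis using reduced_branch_colorable[OF m red refl] h by simp
  qed
  from model_bounded_degree[OF m h this]
  obtain V' :: "nat set" and E' P' where m': "model (verts G) (dominates G) V' E' P'"
    and deg: "\<forall>q\<in>V'. card (E' `` {q}) \<le> h" by blast
  show ?thesis unfolding in_h21_def
    using model_vpt_representation[OF m'] deg by (intro exI[of _ "digraph_of V' E'"] exI[of _ P']) (simp add: out_degree_digraph_of)
qed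

section \<open>Chromatic numbers and vertex deletion\<close>

text \<open>An injective numbering of the finitely many vertices is a proper colouring, so the
  \<open>LEAST\<close> in the definition is attained; and colours below a bound are below every
  larger one.\<close>

lemma chromatic_number_le_iff:
  assumes "finite (verts H)" "arcs_ends H \<subseteq> verts H \<times> verts H" "\<And>v. \<not> v \<rightarrow>\<^bsub>H\<^esub> v"
  shows "chromatic_number H \<le> k \<longleftrightarrow> (\<exists>c. proper_coloring H k c)"
proof
  obtain f :: "'a \<Rightarrow> nat" and n where f: "inj_on f (verts H)" "f ` verts H = {i. i < n}"
    using finite_imp_inj_to_nat_seg[OF assms(1)] by metis
  have "proper_coloring H n f"
    unfolding proper_coloring_def
  proof (intro conjI ballI allI impI)
    show "f v < n" if "v \<in> verts H" for v using f(2) that by auto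
    fix u v assume uv: "u \<rightarrow>\<^bsub>H\<^esub> v"
    then have "u \<in> verts H" "v \<in> verts H" "u \<noteq> v" using assms(2,3) by auto
    then show "f u \<noteq> f v" using f(1) by (auto dest: inj_onD)
  qed
  then have "\<exists>c. proper_coloring H (chromatic_number H) c"
    unfolding chromatic_number_def by (rule LeastI[of "\<lambda>k. \<exists>c. proper_coloring H k c", OF exI])
  then show "\<exists>c. proper_coloring H k c" if "chromatic_number H \<le> k"
    using that unfolding proper_coloring_def by (meson less_le_trans)
  show "chromatic_number H \<le> k" if "\<exists>c. proper_coloring H k c"
    using that unfolding chromatic_number_def by (rule Least_le)
qed

lemma del_vert_adj:
  "u \<rightarrow>\<^bsub>pre_digraph.del_vert G x\<^esub> v \<longleftrightarrow> u \<rightarrow>\<^bsub>G\<^esub> v \<and> u \<noteq> x \<and> v \<noteq> x"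
  by (auto simp: arcs_ends_conv pre_digraph.del_vert_simps)

lemma graph_del_vert:
  assumes "graph G"
  shows "graph (pre_digraph.del_vert G x)"
proof -
  interpret graph G by fact
  show ?thesis
  proof
    show "symmetric (del_vert x)"
      using arcs_ends_symmetric[OF sym_arcs] unfolding symmetric_def sym_def del_vert_adj by blast
  qed (auto simp: pre_digraph.del_vert_simps no_loops arc_to_ends_def intro!: no_multi_arcs)
qed

lemma complete_set_del_vert:
  "complete_set (pre_digraph.del_vert G x) D \<longleftrightarrow> complete_set G D \<and> x \<notin> D"
  unfolding complete_set_def del_vert_adj pre_digraph.verts_del_vert by auto

lemma clique_del_vert:
  assumes "K \<in> cliques G" "x \<notin> K"
  shows "K \<in> cliques (pre_digraph.del_vert G x)"
  using assms unfolding cliques_def complete_set_del_vert by simp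

lemma branch_verts_del_vert:
  "x \<notin> K \<Longrightarrow> branch_verts (pre_digraph.del_vert G x) K = branch_verts G K - {x}"
  unfolding branch_verts_def by (auto simp: pre_digraph.verts_del_vert del_vert_adj)

text \<open>Adjacency of two vertices in the branch graph depends only on their mutual adjacency and
  on \<open>K\<close>, which the deletion of \<open>x\<close> leaves intact. So deleting a vertex
  commutes with forming the branch graph.\<close>

lemma branch_graph_del_vert_adj:
  assumes "x \<notin> K"
  shows "u \<rightarrow>\<^bsub>branch_graph (pre_digraph.del_vert G x) K\<^esub> v \<longleftrightarrow> u \<rightarrow>\<^bsub>pre_digraph.del_vert (branch_graph G K) x\<^esub> v"
  unfolding branch_graph_adj branch_verts_del_vert[OF assms] del_vert_adj using assms by blast

lemma chromatic_branch_graph_le_iff: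
  assumes "graph G"
  shows "chromatic_number (branch_graph G K) \<le> k \<longleftrightarrow> (\<exists>c. proper_coloring (branch_graph G K) k c)"
proof (rule chromatic_number_le_iff)
  interpret graph G by fact
  show "finite (verts (branch_graph G K))" by (simp add: branch_verts_def)
qed (auto simp: branch_graph_adj)

lemma chromatic_branch_graph_del_vert_le_iff:
  assumes "graph G"
  shows "chromatic_number (pre_digraph.del_vert (branch_graph G K) x) \<le> k
    \<longleftrightarrow> (\<exists>c. proper_coloring (pre_digraph.del_vert (branch_graph G K) x) k c)"
proof (rule chromatic_number_le_iff)
  interpret graph G by fact
  show "finite (verts (pre_digraph.del_vert (branch_graph G K) x))" by (simp add: branch_verts_def pre_digraph.verts_del_vert)
qed (auto simp: branch_graph_adj del_vert_adj pre_digraph.verts_del_vert)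

section \<open>Branch graphs of minimal graphs outside the class\<close>

lemma minimal_non_h21_branch_del_vert:
  assumes "graph G" "minimal_non_h21 h G" "K \<in> cliques G" "x \<in> verts G - K"
  shows "\<exists>c. proper_coloring (pre_digraph.del_vert (branch_graph G K) x) h c"
proof -
  have x: "x \<notin> K" using assms by blast
  have "in_h21 h (pre_digraph.del_vert G x)" using assms unfolding minimal_non_h21_def by blast
  then obtain c where "proper_coloring (branch_graph (pre_digraph.del_vert G x) K) h c"
    using in_h21_branch_colorable graph_del_vert clique_del_vert[OF _ x] assms by metis
  then show ?thesis unfolding proper_coloring_def branch_graph_del_vert_adj[OF x]
    by (auto simp: branch_verts_del_vert[OF x] pre_digraph.verts_del_vert)
qed

text \<open>Some clique has a branch graph that is not \<open>h\<close>-colourable, for otherwise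
  \<open>G\<close> would be in the class; a principal clique attains the maximum.\<close>

lemma minimal_non_h21_principal_chromatic:
  assumes G: "graph G" and "VPT G" "h \<ge> 3" "minimal_non_h21 h G" and K: "principal_clique G K"
  shows "chromatic_number (branch_graph G K) > h"
proof -
  interpret graph G by fact
  have "\<not> in_h21 h G" using assms unfolding minimal_non_h21_def by blast
  then obtain C where C: "C \<in> cliques G" "\<nexists>c. proper_coloring (branch_graph G C) h c"
    using in_h21I[OF G] assms by blast
  have "cliques G \<subseteq> Pow (verts G)" unfolding cliques_def complete_set_def by blast
  then have "finite (cliques G)" by (rule finite_subset) simp
  then have "chromatic_number (branch_graph G C) \<le> (MAX C\<in>cliques G. chromatic_number (branch_graph G C))"
    using C(1) by (intro Max_ge) auto
  moreover have "h < chromatic_number (branch_graph G C)"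
    using chromatic_branch_graph_le_iff[OF G, of C h] C(2) by (simp add: not_le)
  ultimately show ?thesis using K unfolding principal_clique_def by simp
qed

text \<open>Intersecting paths that avoid \<open>q\<close> leave \<open>q\<close> in the same
  direction. Used in contrapositive form: crossing neighbourhoods in \<open>K\<close> with a common
  element force non-adjacency.\<close>

lemma adjacent_not_crossing:
  assumes G: "graph G" and vpt: "VPT G" and K: "K \<in> cliques G"
    and s: "s \<in> verts G - K" and w: "w \<in> verts G - K" "s \<rightarrow>\<^bsub>G\<^esub> w"
    and x: "x \<in> K" "x \<rightarrow>\<^bsub>G\<^esub> s" "x \<rightarrow>\<^bsub>G\<^esub> w" and y: "y \<in> K" "y \<rightarrow>\<^bsub>G\<^esub> s" and z: "z \<in> K" "z \<rightarrow>\<^bsub>G\<^esub> w"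
  shows "y \<rightarrow>\<^bsub>G\<^esub> w \<or> z \<rightarrow>\<^bsub>G\<^esub> s"
proof -
  interpret G: graph G by (rule G)
  obtain T :: "(nat, nat \<times> nat) pre_digraph" and P where "vpt_representation G T P"
    using vpt unfolding VPT_def by blast
  note m = vpt_representation_model[OF this]
  interpret host_tree "verts T" "arcs_ends T" using m unfolding model_def by blast
  obtain q where q: "q \<in> verts T" "\<And>x. x \<in> K \<Longrightarrow> q \<in> P x" "\<And>v. v \<in> verts G - K \<Longrightarrow> q \<notin> P v"
    using clique_center[OF G m K] by blast
  have sG: "s \<in> verts G" "w \<in> verts G" "s \<noteq> w" using s w G.adj_not_same by auto
  obtain a where a: "(q, a) \<in> arcs_ends T" "\<And>S. edge_cut (arcs_ends T) q a S \<Longrightarrow> P s \<inter> S = {}"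
    using branch_direction[OF q(1) model_pathD(3,1,2)[OF m sG(1)] q(3)[OF s]] by metis
  obtain S where S: "edge_cut (arcs_ends T) q a S" using cuts a by blast
  obtain t where t: "t \<in> P s" "t \<in> P w" using m sG w(2) unfolding model_def by blast
  \<comment> \<open>The path of \<open>w\<close> meets that of \<open>s\<close> beyond the edge
    \<open>qa\<close>; to reach \<open>S\<close> it would have to contain \<open>q\<close>.\<close>
  have "P w \<inter> S = {}"
    using convex_inD[OF model_pathD(3)[OF m sG(2)] a(1) S _ t(2)] a(2)[OF S] t(1) q(3)[OF w(1)] by blast
  then show ?thesis using clique_model_same_branch[OF G m K q(2) a(1) S s a(2)[OF S] w(1) _ x y z] by blast
qed

theorem theorem12:
  fixes G :: "('a, 'b) pre_digraph" and K :: "'a set" and h :: nat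
  assumes "h \<ge> 3"
    and "graph G" and "connected G"
    and "VPT G"
    and "minimal_non_h21 h G"
    and "principal_clique G K"
  shows "verts (branch_graph G K) = verts G - K
    \<and> (\<forall>v \<in> verts G - K. card (nbhd G v \<inter> K) > 1)
    \<and> vertex_critical (h + 1) (branch_graph G K)
    \<and> (\<forall>s1 \<in> verts G - K. \<forall>s2 \<in> verts G - K.
         s1 \<noteq> s2 \<longrightarrow> nbhd G s1 \<inter> K \<noteq> nbhd G s2 \<inter> K)"
proof -
  interpret G: graph G by fact
  let ?B = "branch_graph G K"
  have K: "K \<in> cliques G" using assms(6) unfolding principal_clique_def by blast
  have fK: "finite K" by (rule clique_finite[OF assms(2) K])
  have sym: "u \<rightarrow>\<^bsub>G\<^esub> v \<longleftrightarrow> v \<rightarrow>\<^bsub>G\<^esub> u" for u v using arcs_ends_symmetric[OF G.sym_arcs] by blast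
  have nocol: "\<not> proper_coloring ?B h c" for c
    using minimal_non_h21_principal_chromatic[OF assms(2,4,1,5,6)]
      chromatic_branch_graph_le_iff[OF assms(2), of K h] by (auto simp: not_le)
  note col = minimal_non_h21_branch_del_vert[OF assms(2,5) K]
  have BV: "branch_verts G K \<subseteq> verts G - K" unfolding branch_verts_def by blast
  \<comment> \<open>Since the branch graph is not \<open>h\<close>-colourable, no colour can be free
    for a deleted vertex. Each part of the claim about neighbourhoods in \<open>K\<close> is refuted
    by exhibiting a free colour \<open>k\<close>.\<close>
  have extend: False
    if v: "v \<in> verts G - K" and c: "proper_coloring (pre_digraph.del_vert ?B v) h c"
      and k: "k < h" "\<And>u. v \<rightarrow>\<^bsub>?B\<^esub> u \<Longrightarrow> k \<noteq> c u" for v c k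
  proof -
    have "proper_coloring ?B h (c(v := k))"
      unfolding proper_coloring_def
    proof (intro conjI ballI allI impI)
      show "(c(v := k)) u < h" if "u \<in> verts ?B" for u
        using that c k(1) unfolding proper_coloring_def by (auto simp: pre_digraph.verts_del_vert)
      fix u u' assume uu: "u \<rightarrow>\<^bsub>?B\<^esub> u'"
      then have "u' \<rightarrow>\<^bsub>?B\<^esub> u" "u \<noteq> u'" using sym unfolding branch_graph_adj by blast+
      then show "(c(v := k)) u \<noteq> (c(v := k)) u'"
        using uu k(2)[of u] k(2)[of u'] c unfolding proper_coloring_def del_vert_adj by auto
    qed
    then show False using nocol by blast
  qed
  have many: "\<exists>x y. x \<in> K \<and> y \<in> K \<and> x \<noteq> y \<and> v \<rightarrow>\<^bsub>G\<^esub> x \<and> v \<rightarrow>\<^bsub>G\<^esub> y" if v: "v \<in> verts G - K" for v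
  proof (rule ccontr)
    assume n: "\<not> ?thesis"
    obtain c where c: "proper_coloring (pre_digraph.del_vert ?B v) h c" using col[OF v] by blast
    \<comment> \<open>A branch neighbour requires two different neighbours of \<open>v\<close> in
      \<open>K\<close>, a shared one and a private one. With at most one, \<open>v\<close> is
      isolated or absent, and the colour 0 is free.\<close>
    have "\<not> v \<rightarrow>\<^bsub>?B\<^esub> u" for u using n sym unfolding branch_graph_adj by blast
    then show False using extend[OF v c, of 0] assms(1) by simp
  qed
  then have "verts G - K \<subseteq> branch_verts G K" unfolding branch_verts_def by blast
  then have verts: "verts ?B = verts G - K" using BV by simp
  have deg: "card (nbhd G v \<inter> K) > 1" if v: "v \<in> verts G - K" for v
  proof -
    obtain x y where "x \<in> K" "y \<in> K" "x \<noteq> y" "v \<rightarrow>\<^bsub>G\<^esub> x" "v \<rightarrow>\<^bsub>G\<^esub> y" using many[OF v] by blast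
    then have "{x, y} \<subseteq> nbhd G v \<inter> K" "card {x, y} = 2" unfolding nbhd_def by auto
    then show ?thesis using card_mono[of "nbhd G v \<inter> K" "{x, y}"] fK by simp
  qed
  have gt: "chromatic_number ?B > h" by (rule minimal_non_h21_principal_chromatic[OF assms(2,4,1,5,6)])
  \<comment> \<open>This provides a vertex to which the additional colour can be given
    below.\<close>
  have "verts ?B \<noteq> {}"
  proof
    assume "verts ?B = {}"
    then have "proper_coloring ?B h (\<lambda>_. 0)" unfolding proper_coloring_def branch_graph_adj by simp
    then show False using nocol by blast
  qed
  then obtain v where v: "v \<in> verts G - K" using verts by blast
  obtain c where c: "proper_coloring (pre_digraph.del_vert ?B v) h c" using col[OF v] by blast
  \<comment> \<open>The other vertices use colours below \<open>h\<close>, so \<open>h\<close>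
    itself is new and can be given to \<open>v\<close>.\<close>
  have "proper_coloring ?B (h + 1) (c(v := h))"
    unfolding proper_coloring_def
  proof (intro conjI ballI allI impI)
    have lt: "c u < h" if "u \<in> branch_verts G K" "u \<noteq> v" for u
      using that c unfolding proper_coloring_def by (auto simp: pre_digraph.verts_del_vert)
    show "(c(v := h)) u < h + 1" if "u \<in> verts ?B" for u using that lt[of u] by (auto simp: less_Suc_eq)
    fix u u' assume uu: "u \<rightarrow>\<^bsub>?B\<^esub> u'"
    then have "u \<in> branch_verts G K" "u' \<in> branch_verts G K" "u \<noteq> u'" unfolding branch_graph_adj by blast+
    then show "(c(v := h)) u \<noteq> (c(v := h)) u'"
      using uu lt[of u] lt[of u'] c unfolding proper_coloring_def del_vert_adj by auto
  qed
  then have "chromatic_number ?B \<le> h + 1" using chromatic_branch_graph_le_iff[OF assms(2)] by blast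
  then have chi: "chromatic_number ?B = h + 1" using gt by simp
  moreover have "chromatic_number (pre_digraph.del_vert ?B x) < h + 1" if "x \<in> verts G - K" for x
    using chromatic_branch_graph_del_vert_le_iff[OF assms(2)] col[OF that] by (simp add: less_Suc_eq_le)
  ultimately have crit: "vertex_critical (h + 1) ?B" unfolding vertex_critical_def using verts by simp
  have "nbhd G s1 \<inter> K \<noteq> nbhd G s2 \<inter> K" if s: "s1 \<in> verts G - K" "s2 \<in> verts G - K" "s1 \<noteq> s2" for s1 s2
  proof
    assume "nbhd G s1 \<inter> K = nbhd G s2 \<inter> K"
    then have same: "x \<rightarrow>\<^bsub>G\<^esub> s1 \<longleftrightarrow> x \<rightarrow>\<^bsub>G\<^esub> s2" if "x \<in> K" for x
      using that sym unfolding nbhd_def by blast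
    obtain c where c: "proper_coloring (pre_digraph.del_vert ?B s1) h c" using col[OF s(1)] by blast
    have "c s2 < h" using c s verts unfolding proper_coloring_def by (auto simp: pre_digraph.verts_del_vert)
    \<comment> \<open>The colour of \<open>s2\<close> is free for \<open>s1\<close>, because every
      branch neighbour of \<open>s1\<close> is one of \<open>s2\<close>.\<close>
    moreover have "c s2 \<noteq> c u" if u: "s1 \<rightarrow>\<^bsub>?B\<^esub> u" for u
    proof -
      obtain x y z where x: "x \<in> K" "x \<rightarrow>\<^bsub>G\<^esub> s1" "x \<rightarrow>\<^bsub>G\<^esub> u" and y: "y \<in> K" "y \<rightarrow>\<^bsub>G\<^esub> s1" "\<not> y \<rightarrow>\<^bsub>G\<^esub> u"
        and z: "z \<in> K" "z \<rightarrow>\<^bsub>G\<^esub> u" "\<not> z \<rightarrow>\<^bsub>G\<^esub> s1" and uB: "u \<in> branch_verts G K"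
        using u unfolding branch_graph_adj by blast
      \<comment> \<open>The conditions on \<open>K\<close> pass from \<open>s1\<close> to
        \<open>s2\<close> by equality of the neighbourhoods; non-adjacency in \<open>G\<close> does
        not, and follows from the crossing instead.\<close>
      have "\<not> s2 \<rightarrow>\<^bsub>G\<^esub> u"
        using adjacent_not_crossing[OF assms(2,4) K s(2) _ _ x(1) _ x(3) y(1) _ z(1,2)] uB BV x y z same by blast
      then have "s2 \<rightarrow>\<^bsub>?B\<^esub> u" unfolding branch_graph_adj
        using x y z same uB s(2) verts by auto
      moreover have "u \<noteq> s1" using y by blast
      ultimately show ?thesis using c s(3) unfolding proper_coloring_def del_vert_adj by blast
    qed
    ultimately show False using extend[OF s(1) c] by blast
  qed
  then show ?thesis using verts deg crit by blast
qed

end
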